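(* Let $n=4$ and let $J$ be a matroidal ideal of degree $d$ in $R=K[x_1,x_2,x_3,x_4]$ with $\gcd(J)=1$. Then $J$ is sequentially Cohen-Macaulay (SCM) if and only if $J$ is (a) a square-free Veronese ideal, or (b) an almost square-free Veronese ideal.
   Context: $K$ is a field; $R$ has the standard grading. For a monomial ideal $I$, $G(I)$ is its unique minimal set of monomial generators, $\gcd(I)$ is the greatest common divisor of the elements of $G(I)$, and $\operatorname{supp}(I)$ is the set of variables dividing some element of $G(I)$. A monomial ideal $I$ generated in one degree is polymatroidal if for all $u,v\in G(I)$ and every $i$ with $\deg_{x_i}(v)<\deg_{x_i}(u)$ there is $j$ with $\deg_{x_j}(u)<\deg_{x_j}(v)$ and $x_j(u/x_i)\in G(I)$; it is matroidal if moreover it is generated by square-free monomials. Standing assumption: the given matroidal ideal of $R$ is fully supported, i.e. $\operatorname{supp}(J)=\{x_1,x_2,x_3,x_4\}$. The square-free Veronese ideal of degree $d$ is generated by all square-free monomials of degree $d$ in $R$. If $I$ is the square-free Veronese ideal of degree $d$, an almost square-free Veronese ideal of degree $d$ is a nonzero monomial ideal $L$ with $G(L)\subseteq G(I)$ and $|G(L)|\ge |G(I)|-1$. A graded module $M$ is sequentially Cohen-Macaulay if there is a finite filtration by graded submodules $0=M_0\subset M_1\subset\dots\subset M_r=M$ with each $M_i/M_{i-1}$ Cohen-Macaulay and $\dim(M_1/M_0)<\dots<\dim(M_r/M_{r-1})$; an ideal $I\subset R$ is called SCM if $R/I$ is sequentially Cohen-Macaulay. *)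

theory Defs
  imports
    "HOL-Algebra.Module"
    "HOL-Algebra.Algebraic_Closure_Type"
    "HOL-Library.Poly_Mapping"
    "HOL-Library.Numeral_Type"
    "HOL-Library.Extended_Nat"
begin

section \<open>Dimension, depth and sequentially Cohen-Macaulay modules\<close>

definition annihilator :: "('a, 'r) ring_scheme \<Rightarrow> ('a, 'b, 'm) module_scheme \<Rightarrow> 'a set" where
  "annihilator R M = {r \<in> carrier R. \<forall>x\<in>carrier M. r \<odot>\<^bsub>M\<^esub> x = \<zero>\<^bsub>M\<^esub>}"

text \<open>
  Krull dimension of a finitely generated module, i.e. of \<open>R / Ann M\<close>, as the supremum of the
  lengths of chains of primes containing the annihilator. The zero module gets dimension 0 rather
  than \<open>-\<infinity>\<close>; below, dimensions are only taken of nonzero modules.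
\<close>
definition module_dim :: "('a, 'r) ring_scheme \<Rightarrow> ('a, 'b, 'm) module_scheme \<Rightarrow> enat" where
  "module_dim R M = Sup {enat k | k. \<exists>P.
     (\<forall>i\<le>k. primeideal (P i) R \<and> annihilator R M \<subseteq> P i) \<and> (\<forall>i<k. P i \<subset> P (Suc i))}"

text \<open>The submodule \<open>(f\<^sub>1, \<dots>, f\<^sub>k) M\<close>.\<close>
definition list_smult :: "'a list \<Rightarrow> ('a, 'b, 'm) module_scheme \<Rightarrow> 'b set" where
  "list_smult fs M =
     {(\<Oplus>\<^bsub>M\<^esub>i\<in>{..<length fs}. (fs ! i) \<odot>\<^bsub>M\<^esub> u i) | u. u \<in> {..<length fs} \<rightarrow> carrier M}"

text \<open>
  The second condition says that \<open>f\<^sub>i\<^sub>+\<^sub>1\<close> is a nonzerodivisor on \<open>M / (f\<^sub>1, \<dots>, f\<^sub>i) M\<close>.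
\<close>
definition regular_sequence :: "('a, 'r) ring_scheme \<Rightarrow> ('a, 'b, 'm) module_scheme \<Rightarrow> 'a list \<Rightarrow> bool" where
  "regular_sequence R M fs \<longleftrightarrow>
     set fs \<subseteq> carrier R \<and>
     (\<forall>i<length fs. \<forall>x\<in>carrier M.
        (fs ! i) \<odot>\<^bsub>M\<^esub> x \<in> list_smult (take i fs) M \<longrightarrow> x \<in> list_smult (take i fs) M) \<and>
     list_smult fs M \<noteq> carrier M"

definition depth :: "('a, 'r) ring_scheme \<Rightarrow> 'a set \<Rightarrow> ('a, 'b, 'm) module_scheme \<Rightarrow> enat" where
  "depth R \<mm> M = Sup {enat (length fs) | fs. regular_sequence R M fs \<and> set fs \<subseteq> \<mm>}"

text \<open>
  Intended for finitely generated graded modules over a standard graded algebra \<open>R\<close> with graded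
  maximal ideal \<open>\<mm>\<close>.
\<close>
definition cohen_macaulay :: "('a, 'r) ring_scheme \<Rightarrow> 'a set \<Rightarrow> ('a, 'b, 'm) module_scheme \<Rightarrow> bool" where
  "cohen_macaulay R \<mm> M \<longleftrightarrow> depth R \<mm> M = module_dim R M"

text \<open>
  \<open>M/N\<close> has the additive cosets as elements. Modules are modelled as extensions of the record of
  rings whose multiplication and unit are irrelevant. The union below is the single coset
  \<open>N + r x\<close>, where \<open>x\<close> is any representative of \<open>A\<close>.
\<close>
definition quot_module :: "('a, 'b, 'm) module_scheme \<Rightarrow> 'b set \<Rightarrow> ('a, 'b set) module" where
  "quot_module M N =
     \<lparr>carrier = a_rcosets\<^bsub>M\<^esub> N, monoid.mult = undefined, one = undefined, ring.zero = N, add = set_add M,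
      module.smult = (\<lambda>r A. \<Union>x\<in>A. N +>\<^bsub>M\<^esub> (r \<odot>\<^bsub>M\<^esub> x))\<rparr>"

text \<open>
  A grading is the family \<open>gr\<close> of its homogeneous components, indexed by \<open>nat\<close>. A submodule of a
  graded module is graded iff each of its elements is a sum of homogeneous elements of the submodule.
\<close>
definition graded_submodule ::
  "('a, 'r) ring_scheme \<Rightarrow> ('a, 'b, 'm) module_scheme \<Rightarrow> (nat \<Rightarrow> 'b set) \<Rightarrow> 'b set \<Rightarrow> bool" where
  "graded_submodule R M gr N \<longleftrightarrow> submodule N R M \<and>
     (\<forall>x\<in>N. \<exists>D c. finite D \<and> (\<forall>d\<in>D. c d \<in> N \<inter> gr d) \<and> x = (\<Oplus>\<^bsub>M\<^esub>d\<in>D. c d))"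

text \<open>
  The module \<open>M\<^sub>i / M\<^sub>i\<^sub>-\<^sub>1\<close> of the filtration is \<open>quot_module (M\<lparr>carrier := F i\<rparr>) (F (i - 1))\<close>.
\<close>
definition sequentially_cohen_macaulay ::
  "('a, 'r) ring_scheme \<Rightarrow> 'a set \<Rightarrow> ('a, 'b, 'm) module_scheme \<Rightarrow> (nat \<Rightarrow> 'b set) \<Rightarrow> bool" where
  "sequentially_cohen_macaulay R \<mm> M gr \<longleftrightarrow> (\<exists>r F.
     (\<forall>i\<le>r. graded_submodule R M gr (F i)) \<and>
     F 0 = {\<zero>\<^bsub>M\<^esub>} \<and> F r = carrier M \<and>
     (\<forall>i<r. F i \<subset> F (Suc i)) \<and>
     (\<forall>i<r. cohen_macaulay R \<mm> (quot_module (M\<lparr>carrier := F (Suc i)\<rparr>) (F i))) \<and>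
     (\<forall>i. Suc i < r \<longrightarrow>
        module_dim R (quot_module (M\<lparr>carrier := F (Suc i)\<rparr>) (F i)) <
        module_dim R (quot_module (M\<lparr>carrier := F (Suc (Suc i))\<rparr>) (F (Suc i)))))"

definition ring_as_module :: "('a, 'r) ring_scheme \<Rightarrow> ('a, 'a) module" where
  "ring_as_module R =
     \<lparr>carrier = carrier R, monoid.mult = monoid.mult R, one = one R, ring.zero = ring.zero R, add = add R,
      module.smult = monoid.mult R\<rparr>"


section \<open>Monomial ideals in polynomial rings\<close>

text \<open>
  The type \<open>'v\<close> indexes the variables. A monomial is identified with its exponent vector, so that
  the monomial 1 is \<open>0\<close> and the product of monomials is \<open>+\<close>. The order which the library puts on
  finitely supported functions is lexicographic; divisibility of monomials is \<open>mono_dvd\<close>.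
\<close>
type_synonym 'v mono = "'v \<Rightarrow>\<^sub>0 nat"
type_synonym ('v, 'k) mpoly = "'v mono \<Rightarrow>\<^sub>0 'k"

abbreviation mpoly_ring :: "('v, 'k::field) mpoly ring" where
  "mpoly_ring \<equiv> ring_of_type_algebra"

definition monomial_poly :: "'v mono \<Rightarrow> ('v, 'k::field) mpoly" where
  "monomial_poly u = Poly_Mapping.single u 1"

definition mono_deg :: "'v::finite mono \<Rightarrow> nat" where
  "mono_deg u = (\<Sum>i\<in>UNIV. Poly_Mapping.lookup u i)"

definition mono_dvd :: "'v mono \<Rightarrow> 'v mono \<Rightarrow> bool" where
  "mono_dvd u v \<longleftrightarrow> (\<exists>w. v = u + w)"

definition mono_squarefree :: "'v mono \<Rightarrow> bool" where
  "mono_squarefree u \<longleftrightarrow> (\<forall>i. Poly_Mapping.lookup u i \<le> 1)"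

definition monomial_span_ideal :: "'v mono set \<Rightarrow> ('v, 'k::field) mpoly set" where
  "monomial_span_ideal S = Idl\<^bsub>mpoly_ring\<^esub> (monomial_poly ` S)"

definition monomial_ideal :: "('v, 'k::field) mpoly set \<Rightarrow> bool" where
  "monomial_ideal I \<longleftrightarrow> (\<exists>S. I = monomial_span_ideal S)"

definition min_monomial_gens :: "('v, 'k::field) mpoly set \<Rightarrow> 'v mono set" where
  "min_monomial_gens I = (THE S. monomial_span_ideal S = I \<and>
     (\<forall>T. T \<subset> S \<longrightarrow> monomial_span_ideal T \<noteq> I))"

definition ideal_gcd :: "('v, 'k::field) mpoly set \<Rightarrow> 'v mono" where
  "ideal_gcd I = (THE g. (\<forall>u\<in>min_monomial_gens I. mono_dvd g u) \<and>
     (\<forall>h. (\<forall>u\<in>min_monomial_gens I. mono_dvd h u) \<longrightarrow> mono_dvd h g))"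

definition ideal_supp :: "('v, 'k::field) mpoly set \<Rightarrow> 'v set" where
  "ideal_supp I = {i. \<exists>u\<in>min_monomial_gens I. mono_dvd (Poly_Mapping.single i 1) u}"

text \<open>The degree \<open>d\<close> of the generators is made explicit.\<close>
definition polymatroidal_ideal :: "nat \<Rightarrow> ('v::finite, 'k::field) mpoly set \<Rightarrow> bool" where
  "polymatroidal_ideal d I \<longleftrightarrow> monomial_ideal I \<and>
     (\<forall>u\<in>min_monomial_gens I. mono_deg u = d) \<and>
     (\<forall>u\<in>min_monomial_gens I. \<forall>v\<in>min_monomial_gens I. \<forall>i.
        Poly_Mapping.lookup v i < Poly_Mapping.lookup u i \<longrightarrow>
        (\<exists>j. Poly_Mapping.lookup u j < Poly_Mapping.lookup v j \<and>
           Poly_Mapping.single j 1 + (u - Poly_Mapping.single i 1) \<in> min_monomial_gens I))"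

definition matroidal_ideal :: "nat \<Rightarrow> ('v::finite, 'k::field) mpoly set \<Rightarrow> bool" where
  "matroidal_ideal d I \<longleftrightarrow>
     polymatroidal_ideal d I \<and> (\<forall>u\<in>min_monomial_gens I. mono_squarefree u)"

definition sqfree_veronese :: "nat \<Rightarrow> ('v::finite, 'k::field) mpoly set" where
  "sqfree_veronese d = monomial_span_ideal {u. mono_squarefree u \<and> mono_deg u = d}"

definition almost_sqfree_veronese :: "nat \<Rightarrow> ('v::finite, 'k::field) mpoly set \<Rightarrow> bool" where
  "almost_sqfree_veronese d L \<longleftrightarrow> monomial_ideal L \<and> L \<noteq> {0} \<and>
     min_monomial_gens L \<subseteq> min_monomial_gens (sqfree_veronese d :: ('v, 'k) mpoly set) \<and>
     card (min_monomial_gens L) \<ge>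
       card (min_monomial_gens (sqfree_veronese d :: ('v, 'k) mpoly set)) - 1"

definition graded_maximal_ideal :: "('v, 'k::field) mpoly set" where
  "graded_maximal_ideal = monomial_span_ideal (range (\<lambda>i. Poly_Mapping.single i 1))"

definition homogeneous_polys :: "nat \<Rightarrow> ('v::finite, 'k::field) mpoly set" where
  "homogeneous_polys d = {p. \<forall>u\<in>Poly_Mapping.keys p. mono_deg u = d}"

text \<open>The grading of \<open>R/I\<close> is the image of the standard grading of \<open>R\<close>.\<close>
definition SCM :: "('v::finite, 'k::field) mpoly set \<Rightarrow> bool" where
  "SCM I \<longleftrightarrow> sequentially_cohen_macaulay mpoly_ring graded_maximal_ideal
     (quot_module (ring_as_module mpoly_ring) I)
     (\<lambda>d. (\<lambda>p. I +>\<^bsub>mpoly_ring\<^esub> p) ` homogeneous_polys d)"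

end

theory Submission
  imports Defs
begin

text \<open>
  The generators of \<open>J\<close> are the bases of a matroid on four elements. Full support and
  \<open>gcd(J) = 1\<close> say that every element lies in some basis and that none lies in all of them.
  There are few such matroids (\<open>matroid_on_four\<close>): those of rank 1, 2 or 3 in which all sets of that
  size are bases, and two kinds of rank 2, where the bases are all pairs except one, or all pairs
  except two disjoint ones. The first two kinds are the square-free Veronese and the almost
  square-free Veronese ideals, and it remains to decide which of the three kinds are SCM. For this,
  \<open>J\<close> is regarded as the Stanley-Reisner ideal of the complex of all sets that contain no basis.

  For a Veronese ideal of degree \<open>d\<close> the complex consists of all sets of at most \<open>d - 1 \<le> 2\<close>
  elements, and \<open>R/J\<close> is Cohen-Macaulay: the first \<open>d - 1\<close> elementary symmetric polynomials form a
  regular sequence (\<open>cohen_macaulay_skeleton\<close>). For \<open>d = 3\<close> this is proved by attaching the edges of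
  the complete graph one at a time (\<open>regular_second_attach_edge\<close>). If one pair \<open>{i, j}\<close> is missing,
  the complex is the edge \<open>{i, j}\<close> together with two isolated points. Then the ideal of the edge gives
  a filtration of \<open>R/J\<close> with Cohen-Macaulay quotients of dimensions 1 and 2
  (\<open>cohen_macaulay_edge_and_points\<close>). If two disjoint pairs are missing, the complex consists of two
  disjoint edges. It is pure, so a filtration can have only one step, but it is disconnected, so the
  depth is only 1 (\<open>not_SCM_two_disjoint_faces\<close>).

  The upper bounds for dimension and depth have one common source. The monomials in the elements of
  a regular sequence, and also those in elements picked from the successive differences of a
  chain of primes, are linearly independent (\<open>separating_independent\<close>). Comparing their number with
  the number of monomials outside the ideal shows that neither a regular sequence nor a chain of
  primes can be longer than the largest number of variables in such a monomial
  (\<open>separating_length_le\<close>). The lower bounds come from explicit chains of primes generated by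
  variables and from explicit regular sequences.
\<close>

section \<open>Ideals and primes of a ring given by a type\<close>

definition is_ideal :: "'r::comm_ring_1 set \<Rightarrow> bool" where
  "is_ideal I \<longleftrightarrow> 0 \<in> I \<and> (\<forall>x\<in>I. \<forall>y\<in>I. x + y \<in> I) \<and> (\<forall>r. \<forall>x\<in>I. r * x \<in> I)"

lemma is_idealI:
  assumes "0 \<in> I" "\<And>x y. x \<in> I \<Longrightarrow> y \<in> I \<Longrightarrow> x + y \<in> I" "\<And>r x. x \<in> I \<Longrightarrow> r * x \<in> I"
  shows "is_ideal I"
  using assms by (auto simp: is_ideal_def)

lemma is_ideal_zero: "is_ideal I \<Longrightarrow> 0 \<in> I"
  and is_ideal_add: "is_ideal I \<Longrightarrow> x \<in> I \<Longrightarrow> y \<in> I \<Longrightarrow> x + y \<in> I"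
  and is_ideal_mult: "is_ideal I \<Longrightarrow> x \<in> I \<Longrightarrow> r * x \<in> I"
  by (auto simp: is_ideal_def)

lemma is_ideal_mult_right: "is_ideal I \<Longrightarrow> x \<in> I \<Longrightarrow> x * r \<in> I"
  using is_ideal_mult[of I x r] by (simp add: mult.commute)

lemma is_ideal_uminus: "is_ideal I \<Longrightarrow> x \<in> I \<Longrightarrow> - x \<in> I"
  using is_ideal_mult[of I x "- 1"] by simp

lemma is_ideal_diff: "is_ideal I \<Longrightarrow> x \<in> I \<Longrightarrow> y \<in> I \<Longrightarrow> x - y \<in> I"
  using is_ideal_add[of I x "- y"] is_ideal_uminus by force

lemma is_ideal_sum:
  assumes "is_ideal I" "\<And>i. i \<in> S \<Longrightarrow> f i \<in> I"
  shows "sum f S \<in> I"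
  using assms(2) by (induction S rule: infinite_finite_induct)
    (auto intro: is_ideal_zero is_ideal_add assms(1))

lemma is_ideal_UNIV: "is_ideal UNIV"
  by (simp add: is_ideal_def)

lemma is_ideal_diff_cancel:
  assumes "is_ideal I" "x - y \<in> I" "y \<in> I"
  shows "x \<in> I"
  using is_ideal_add[OF assms] by simp

definition is_prime :: "'r::comm_ring_1 set \<Rightarrow> bool" where
  "is_prime P \<longleftrightarrow> is_ideal P \<and> 1 \<notin> P \<and> (\<forall>a b. a * b \<in> P \<longrightarrow> a \<in> P \<or> b \<in> P)"

lemma carrier_type_ring [simp]: "carrier (ring_of_type_algebra :: 'r::comm_ring_1 ring) = UNIV"
  and mult_type_ring [simp]: "monoid.mult (ring_of_type_algebra :: 'r::comm_ring_1 ring) = (*)"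
  and add_type_ring [simp]: "add (ring_of_type_algebra :: 'r::comm_ring_1 ring) = (+)"
  and one_type_ring [simp]: "one (ring_of_type_algebra :: 'r::comm_ring_1 ring) = 1"
  and zero_type_ring [simp]: "ring.zero (ring_of_type_algebra :: 'r::comm_ring_1 ring) = 0"
  by (simp_all add: ring_of_type_algebra_def)

lemma ideal_type_ring_iff:
  fixes I :: "'r::comm_ring_1 set"
  shows "ideal I (ring_of_type_algebra :: 'r ring) \<longleftrightarrow> is_ideal I"
proof
  let ?R = "ring_of_type_algebra :: 'r ring"
  assume "ideal I ?R"
  then interpret ideal I ?R .
  have "0 \<in> I" using additive_subgroup.zero_closed[OF additive_subgroup_axioms] by simp
  moreover have "x + y \<in> I" if "x \<in> I" "y \<in> I" for x y
    using additive_subgroup.a_closed[OF additive_subgroup_axioms that] by simp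
  moreover have "r * x \<in> I" if "x \<in> I" for x r
    using I_l_closed[OF that, of r] by simp
  ultimately show "is_ideal I" by (auto intro!: is_idealI)
next
  let ?R = "ring_of_type_algebra :: 'r ring"
  assume I: "is_ideal I"
  interpret cring ?R by (rule cring_from_type_algebra)
  have inv: "\<ominus>\<^bsub>?R\<^esub> x = - x" for x
    by (rule minus_equality) auto
  have "subgroup I (add_monoid ?R)"
  proof (rule add.subgroupI)
    show "I \<noteq> {}" using is_ideal_zero[OF I] by auto
    show "\<ominus>\<^bsub>?R\<^esub> a \<in> I" if "a \<in> I" for a
      using is_ideal_uminus[OF I that] by (simp add: inv)
  qed (auto intro: is_ideal_add[OF I])
  then show "ideal I ?R"
    by (intro idealI) (auto intro: is_ideal_mult[OF I] is_ideal_mult_right[OF I] ring_axioms)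
qed

lemma primeideal_type_ring_iff:
  fixes P :: "'r::comm_ring_1 set"
  shows "primeideal P (ring_of_type_algebra :: 'r ring) \<longleftrightarrow> is_prime P"
proof -
  have "UNIV = P \<longleftrightarrow> 1 \<in> P" if "is_ideal P"
    using is_ideal_mult[OF that, of 1] by auto
  then show ?thesis
    unfolding primeideal_def primeideal_axioms_def is_prime_def ideal_type_ring_iff
    by (auto simp: cring_from_type_algebra)
qed

section \<open>Subquotients of a ring as modules\<close>

definition adjoin :: "'r::comm_ring_1 set \<Rightarrow> 'r set \<Rightarrow> 'r \<Rightarrow> 'r set" where
  "adjoin A B f = {a + f * b | a b. a \<in> A \<and> b \<in> B}"

text \<open>
  The recursion passes from \<open>B/A\<close> to \<open>B/(A + f B)\<close>, so that inductions along a regular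
  sequence need no indices.
\<close>
fun reg_seq :: "'r::comm_ring_1 set \<Rightarrow> 'r set \<Rightarrow> 'r list \<Rightarrow> bool" where
  "reg_seq A B [] \<longleftrightarrow> A \<noteq> B"
| "reg_seq A B (f # fs) \<longleftrightarrow> (\<forall>x\<in>B. f * x \<in> A \<longrightarrow> x \<in> A) \<and> reg_seq (adjoin A B f) B fs"

text \<open>
  Dimension of the module \<open>B/A\<close>; the set compared with the primes is the annihilator \<open>(A : B)\<close>.
\<close>
definition subq_dim :: "'r::comm_ring_1 set \<Rightarrow> 'r set \<Rightarrow> enat" where
  "subq_dim A B = Sup {enat k | k. \<exists>P. (\<forall>i\<le>k. is_prime (P i) \<and> {r. \<forall>b\<in>B. r * b \<in> A} \<subseteq> P i) \<and>
     (\<forall>i<k. P i \<subset> P (Suc i))}"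

definition subq_depth :: "'r::comm_ring_1 set \<Rightarrow> 'r set \<Rightarrow> 'r set \<Rightarrow> enat" where
  "subq_depth \<mm> A B = Sup {enat (length fs) | fs. reg_seq A B fs \<and> set fs \<subseteq> \<mm>}"

lemma is_ideal_adjoin:
  assumes A: "is_ideal A" and B: "is_ideal B"
  shows "is_ideal (adjoin A B f)"
proof (rule is_idealI)
  show "0 \<in> adjoin A B f"
    unfolding adjoin_def using is_ideal_zero[OF A] is_ideal_zero[OF B] by force
next
  fix x y assume "x \<in> adjoin A B f" "y \<in> adjoin A B f"
  then obtain a b a' b' where *: "a \<in> A" "b \<in> B" "a' \<in> A" "b' \<in> B" "x = a + f * b" "y = a' + f * b'"
    by (auto simp: adjoin_def)
  then have "x + y = (a + a') + f * (b + b')" by (simp add: algebra_simps)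
  with * show "x + y \<in> adjoin A B f"
    unfolding adjoin_def using is_ideal_add[OF A] is_ideal_add[OF B] by blast
next
  fix r x assume "x \<in> adjoin A B f"
  then obtain a b where *: "a \<in> A" "b \<in> B" "x = a + f * b"
    by (auto simp: adjoin_def)
  then have "r * x = r * a + f * (r * b)" by (simp add: algebra_simps)
  with * show "r * x \<in> adjoin A B f"
    unfolding adjoin_def using is_ideal_mult[OF A] is_ideal_mult[OF B] by blast
qed

lemma adjoin_subset:
  assumes "A \<subseteq> B" "is_ideal B"
  shows "adjoin A B f \<subseteq> B"
  using assms by (auto simp: adjoin_def intro: is_ideal_add is_ideal_mult)

lemma subset_adjoin:
  assumes "is_ideal B"
  shows "A \<subseteq> adjoin A B f"
  using is_ideal_zero[OF assms] by (force simp: adjoin_def)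

lemma mult_in_adjoin:
  assumes "is_ideal A" "b \<in> B"
  shows "f * b \<in> adjoin A B f"
  using is_ideal_zero[OF assms(1)] assms(2) by (force simp: adjoin_def)

text \<open>
  Adjoining the \<open>f\<^sub>i B\<close> to \<open>A\<close> one after the other gives the preimage in \<open>B\<close> of the submodule
  \<open>(f\<^sub>1, \<dots>, f\<^sub>k) (B/A)\<close>. This is the link between the recursive \<open>reg_seq\<close> and regular sequences
  on a module.
\<close>
lemma foldl_adjoin_eq:
  assumes "is_ideal A" "is_ideal B"
  shows "foldl (\<lambda>N. adjoin N B) A fs =
    {a + (\<Sum>i<length fs. fs ! i * u i) | a u. a \<in> A \<and> u \<in> {..<length fs} \<rightarrow> B}"
  using assms(1)
proof (induction fs arbitrary: A)
  case Nil
  then show ?case by auto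
next
  case (Cons f fs)
  have "x \<in> {a + (\<Sum>i<length fs. fs ! i * u i) | a u. a \<in> adjoin A B f \<and> u \<in> {..<length fs} \<rightarrow> B} \<longleftrightarrow>
    x \<in> {a + (\<Sum>i<length (f # fs). (f # fs) ! i * u i) | a u. a \<in> A \<and> u \<in> {..<length (f # fs)} \<rightarrow> B}"
    (is "?L \<longleftrightarrow> ?R") for x
  proof
    assume ?L
    then obtain a b u where *: "a \<in> A" "b \<in> B" "u \<in> {..<length fs} \<rightarrow> B"
      "x = a + f * b + (\<Sum>i<length fs. fs ! i * u i)"
      by (auto simp: adjoin_def)
    define v where "v = (\<lambda>i. case i of 0 \<Rightarrow> b | Suc j \<Rightarrow> u j)"
    have "x = a + (\<Sum>i<length (f # fs). (f # fs) ! i * v i)"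
      by (simp add: * v_def sum.lessThan_Suc_shift del: sum.lessThan_Suc)
    moreover have "v \<in> {..<length (f # fs)} \<rightarrow> B"
      using * by (auto simp: v_def Pi_iff split: nat.split)
    ultimately show ?R using * by blast
  next
    assume ?R
    then obtain a v where *: "a \<in> A" "v \<in> {..<length (f # fs)} \<rightarrow> B"
      "x = a + (\<Sum>i<length (f # fs). (f # fs) ! i * v i)"
      by blast
    have "x = (a + f * v 0) + (\<Sum>i<length fs. fs ! i * v (Suc i))"
      by (simp add: * sum.lessThan_Suc_shift add.assoc del: sum.lessThan_Suc)
    moreover have "a + f * v 0 \<in> adjoin A B f" "(\<lambda>i. v (Suc i)) \<in> {..<length fs} \<rightarrow> B"
      using * by (auto simp: adjoin_def)
    ultimately show ?L
      by (intro CollectI exI[of _ "a + f * v 0"] exI[of _ "\<lambda>i. v (Suc i)"] conjI)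
  qed
  with Cons.IH[OF is_ideal_adjoin[OF Cons.prems assms(2)]] show ?case
    by auto
qed

lemma reg_seq_iff:
  "reg_seq A B fs \<longleftrightarrow>
    (\<forall>i<length fs. \<forall>x\<in>B. fs ! i * x \<in> foldl (\<lambda>N. adjoin N B) A (take i fs) \<longrightarrow>
       x \<in> foldl (\<lambda>N. adjoin N B) A (take i fs)) \<and>
    foldl (\<lambda>N. adjoin N B) A fs \<noteq> B"
  by (induction fs arbitrary: A) (auto simp: All_less_Suc2)

lemma is_ideal_foldl_adjoin:
  assumes "is_ideal A" "is_ideal B"
  shows "is_ideal (foldl (\<lambda>N. adjoin N B) A fs)"
  using assms(1) by (induction fs arbitrary: A) (auto intro: is_ideal_adjoin assms)

lemma foldl_adjoin_subset:
  assumes "is_ideal B" "A \<subseteq> B"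
  shows "foldl (\<lambda>N. adjoin N B) A fs \<subseteq> B"
  using assms(2) by (induction fs arbitrary: A) (auto simp: adjoin_subset assms)

lemma subset_foldl_adjoin:
  assumes "is_ideal B"
  shows "A \<subseteq> foldl (\<lambda>N. adjoin N B) A fs"
  by (induction fs arbitrary: A) (use subset_adjoin[OF assms] in fastforce)+

text \<open>
  The module \<open>Q\<close> is a copy of \<open>B/A\<close> by means of \<open>\<phi>\<close>. Working with an arbitrary copy makes it
  possible to treat \<open>R/J\<close>, its submodules and the quotients of those (whose elements are cosets of
  cosets) all in the same way, and to move every question about them into the ring.
\<close>
locale subquotient =
  fixes Q :: "('r::comm_ring_1, 'b, 'm) module_scheme" and A B :: "'r set" and \<phi> :: "'r \<Rightarrow> 'b"
  assumes ideal_A: "is_ideal A" and ideal_B: "is_ideal B" and A_subset_B: "A \<subseteq> B"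
    and carrier_eq: "carrier Q = \<phi> ` B"
    and add_eq: "p \<in> B \<Longrightarrow> q \<in> B \<Longrightarrow> \<phi> p \<oplus>\<^bsub>Q\<^esub> \<phi> q = \<phi> (p + q)"
    and zero_eq: "\<zero>\<^bsub>Q\<^esub> = \<phi> 0"
    and smult_eq: "p \<in> B \<Longrightarrow> r \<odot>\<^bsub>Q\<^esub> \<phi> p = \<phi> (r * p)"
    and phi_eq_iff: "p \<in> B \<Longrightarrow> q \<in> B \<Longrightarrow> \<phi> p = \<phi> q \<longleftrightarrow> p - q \<in> A"
begin

abbreviation "R \<equiv> (ring_of_type_algebra :: 'r ring)"

lemma abelian_group: "abelian_group Q"
proof (rule abelian_groupI)
  fix x assume "x \<in> carrier Q"
  then obtain p where p: "p \<in> B" "x = \<phi> p" by (auto simp: carrier_eq)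
  then show "\<exists>y\<in>carrier Q. y \<oplus>\<^bsub>Q\<^esub> x = \<zero>\<^bsub>Q\<^esub>"
    using is_ideal_uminus[OF ideal_B p(1)]
    by (auto simp: carrier_eq zero_eq add_eq intro!: bexI[of _ "- p"])
qed (auto simp: carrier_eq add_eq zero_eq is_ideal_add[OF ideal_B] is_ideal_zero[OF ideal_B]
     algebra_simps)

lemma finsum_eq:
  assumes "finite S" "\<And>i. i \<in> S \<Longrightarrow> h i \<in> B"
  shows "(\<Oplus>\<^bsub>Q\<^esub>i\<in>S. \<phi> (h i)) = \<phi> (\<Sum>i\<in>S. h i)"
proof -
  interpret abelian_group Q by (rule abelian_group)
  show ?thesis using assms
  proof (induction S)
    case empty
    then show ?case by (simp add: zero_eq)
  next
    case (insert i S)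
    then have "(\<lambda>i. \<phi> (h i)) \<in> S \<rightarrow> carrier Q" "\<phi> (h i) \<in> carrier Q" "sum h S \<in> B"
      by (auto simp: carrier_eq intro: is_ideal_sum[OF ideal_B])
    with insert show ?case by (simp add: add_eq)
  qed
qed

lemma phi_image_iff:
  assumes "is_ideal N" "A \<subseteq> N" "N \<subseteq> B" "x \<in> B"
  shows "\<phi> x \<in> \<phi> ` N \<longleftrightarrow> x \<in> N"
proof
  assume "\<phi> x \<in> \<phi> ` N"
  then obtain y where "y \<in> N" "\<phi> x = \<phi> y" by auto
  then have "x - y \<in> A" using phi_eq_iff[of x y] assms by auto
  then show "x \<in> N" using is_ideal_diff_cancel[of N x y] assms \<open>y \<in> N\<close> by auto
qed auto

lemma submodule_image:
  assumes "is_ideal N" "N \<subseteq> B"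
  shows "submodule (\<phi> ` N) R Q"
proof -
  interpret abelian_group Q by (rule abelian_group)
  have inv: "\<ominus>\<^bsub>Q\<^esub> \<phi> x = \<phi> (- x)" if "x \<in> N" for x
    using that assms is_ideal_uminus[OF assms(1), of x]
    by (intro minus_equality) (auto simp: carrier_eq add_eq zero_eq subset_iff)
  have "subgroup (\<phi> ` N) (add_monoid Q)"
  proof (rule add.subgroupI)
    show "\<ominus>\<^bsub>Q\<^esub> a \<in> \<phi> ` N" if "a \<in> \<phi> ` N" for a
      using that inv is_ideal_uminus[OF assms(1)] by auto
  qed (use assms is_ideal_zero[OF assms(1)] is_ideal_add[OF assms(1)] in
        \<open>auto simp: carrier_eq add_eq subset_iff\<close>)
  moreover have "r \<odot>\<^bsub>Q\<^esub> y \<in> \<phi> ` N" if "y \<in> \<phi> ` N" for r y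
    using that assms is_ideal_mult[OF assms(1)] by (auto simp: smult_eq subset_iff)
  ultimately show ?thesis
    by (auto simp: submodule_def submodule_axioms_def)
qed

text \<open>
  The submodules of \<open>B/A\<close> correspond to the ideals between \<open>A\<close> and \<open>B\<close>.
\<close>
lemma submodule_preimage:
  assumes "submodule N R Q"
  defines "M \<equiv> {p \<in> B. \<phi> p \<in> N}"
  shows "is_ideal M" "A \<subseteq> M" "N = \<phi> ` M"
proof -
  interpret submodule N R Q by fact
  have z: "\<phi> 0 \<in> N" using one_closed by (simp add: zero_eq)
  show "is_ideal M"
  proof (rule is_idealI)
    show "0 \<in> M" using z is_ideal_zero[OF ideal_B] by (simp add: M_def)
    show "x + y \<in> M" if "x \<in> M" "y \<in> M" for x y
      using that m_closed[of "\<phi> x" "\<phi> y"] is_ideal_add[OF ideal_B] by (auto simp: M_def add_eq)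
    show "r * x \<in> M" if "x \<in> M" for x r
      using that smult_closed[of r "\<phi> x"] is_ideal_mult[OF ideal_B] by (auto simp: M_def smult_eq)
  qed
  show "A \<subseteq> M"
  proof
    fix x assume "x \<in> A"
    then have "\<phi> x = \<phi> 0" using phi_eq_iff[of x 0] A_subset_B is_ideal_zero[OF ideal_B] by auto
    then show "x \<in> M" using z \<open>x \<in> A\<close> A_subset_B by (auto simp: M_def)
  qed
  have "N \<subseteq> carrier Q" using subset by simp
  then show "N = \<phi> ` M" by (auto simp: M_def carrier_eq)
qed

lemma annihilator_eq: "annihilator R Q = {r. \<forall>b\<in>B. r * b \<in> A}"
proof -
  have "r \<odot>\<^bsub>Q\<^esub> \<phi> b = \<zero>\<^bsub>Q\<^esub> \<longleftrightarrow> r * b \<in> A" if "b \<in> B" for r b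
    using that phi_eq_iff[of "r * b" 0] is_ideal_mult[OF ideal_B] is_ideal_zero[OF ideal_B]
    by (simp add: smult_eq zero_eq)
  then show ?thesis by (auto simp: annihilator_def carrier_eq)
qed

lemma module_dim_eq: "module_dim R Q = subq_dim A B"
  by (simp add: module_dim_def subq_dim_def annihilator_eq primeideal_type_ring_iff)

lemma list_smult_eq: "list_smult fs Q = \<phi> ` foldl (\<lambda>N. adjoin N B) A fs"
proof -
  have "x \<in> list_smult fs Q \<longleftrightarrow> x \<in> \<phi> ` foldl (\<lambda>N. adjoin N B) A fs" for x
  proof
    assume "x \<in> list_smult fs Q"
    then obtain u where u: "u \<in> {..<length fs} \<rightarrow> carrier Q"
      "x = (\<Oplus>\<^bsub>Q\<^esub>i\<in>{..<length fs}. (fs ! i) \<odot>\<^bsub>Q\<^esub> u i)"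
      by (auto simp: list_smult_def)
    then have "\<forall>i. \<exists>b. i < length fs \<longrightarrow> b \<in> B \<and> u i = \<phi> b"
      by (auto simp: carrier_eq Pi_iff image_iff)
    then obtain v where v: "\<And>i. i < length fs \<Longrightarrow> v i \<in> B \<and> u i = \<phi> (v i)"
      by metis
    interpret abelian_group Q by (rule abelian_group)
    have "x = (\<Oplus>\<^bsub>Q\<^esub>i\<in>{..<length fs}. \<phi> (fs ! i * v i))"
      unfolding u(2) using v is_ideal_mult[OF ideal_B]
      by (intro finsum_cong') (auto simp: smult_eq carrier_eq)
    also have "\<dots> = \<phi> (0 + (\<Sum>i<length fs. fs ! i * v i))"
      using v is_ideal_mult[OF ideal_B] by (subst finsum_eq) auto
    finally show "x \<in> \<phi> ` foldl (\<lambda>N. adjoin N B) A fs"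
      unfolding foldl_adjoin_eq[OF ideal_A ideal_B]
      using v is_ideal_zero[OF ideal_A] by blast
  next
    assume "x \<in> \<phi> ` foldl (\<lambda>N. adjoin N B) A fs"
    then obtain a v where v: "a \<in> A" "v \<in> {..<length fs} \<rightarrow> B"
      "x = \<phi> (a + (\<Sum>i<length fs. fs ! i * v i))"
      unfolding foldl_adjoin_eq[OF ideal_A ideal_B] by auto
    interpret abelian_group Q by (rule abelian_group)
    have s: "(\<Sum>i<length fs. fs ! i * v i) \<in> B"
      using v by (intro is_ideal_sum[OF ideal_B] is_ideal_mult[OF ideal_B]) auto
    have "x = \<phi> (\<Sum>i<length fs. fs ! i * v i)"
      unfolding v(3) using s v(1) A_subset_B by (subst phi_eq_iff) (auto intro: is_ideal_add[OF ideal_B])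
    also have "\<dots> = (\<Oplus>\<^bsub>Q\<^esub>i\<in>{..<length fs}. \<phi> (fs ! i * v i))"
      using v is_ideal_mult[OF ideal_B] by (subst finsum_eq) auto
    also have "\<dots> = (\<Oplus>\<^bsub>Q\<^esub>i\<in>{..<length fs}. (fs ! i) \<odot>\<^bsub>Q\<^esub> \<phi> (v i))"
      using v is_ideal_mult[OF ideal_B]
      by (intro finsum_cong') (auto simp: smult_eq carrier_eq Pi_iff)
    finally show "x \<in> list_smult fs Q"
      unfolding list_smult_def using v(2) by (auto simp: carrier_eq Pi_iff)
  qed
  then show ?thesis by blast
qed

lemma regular_sequence_iff: "regular_sequence R Q fs \<longleftrightarrow> reg_seq A B fs"
proof -
  let ?N = "\<lambda>fs. foldl (\<lambda>N. adjoin N B) A fs"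
  have mem: "\<phi> x \<in> \<phi> ` ?N gs \<longleftrightarrow> x \<in> ?N gs" if "x \<in> B" for x gs
    using is_ideal_foldl_adjoin[OF ideal_A ideal_B] foldl_adjoin_subset[OF ideal_B A_subset_B]
      subset_foldl_adjoin[OF ideal_B] that
    by (intro phi_image_iff) auto
  then have "\<phi> ` ?N gs = \<phi> ` B \<longleftrightarrow> ?N gs = B" for gs
    using foldl_adjoin_subset[OF ideal_B A_subset_B, of gs] by blast
  with mem show ?thesis
    by (simp add: regular_sequence_def reg_seq_iff list_smult_eq carrier_eq smult_eq
        is_ideal_mult[OF ideal_B])
qed

lemma depth_eq: "depth R \<mm> Q = subq_depth \<mm> A B"
  by (simp add: depth_def subq_depth_def regular_sequence_iff)

end

section \<open>Monomials in a regular sequence or prime chain are independent\<close>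

fun power_prod :: "'r::comm_ring_1 list \<Rightarrow> nat list \<Rightarrow> 'r" where
  "power_prod (a # as) (e # es) = a ^ e * power_prod as es"
| "power_prod _ _ = 1"

text \<open>
  The common feature of a regular sequence on \<open>B/N\<close> and of a list of elements chosen from the
  successive differences of a chain of primes starting at \<open>N\<close>: there is an increasing chain of
  ideals such that every \<open>a\<close> in the list is a nonzerodivisor on \<open>B\<close> modulo one ideal of the chain
  and annihilates \<open>B\<close> modulo the next one, and \<open>z\<close> lies outside the last ideal.
\<close>
fun separating :: "'r::comm_ring_1 set \<Rightarrow> 'r \<Rightarrow> 'r list \<Rightarrow> 'r set \<Rightarrow> bool" where
  "separating B z [] N \<longleftrightarrow> z \<notin> N"
| "separating B z (a # as) N \<longleftrightarrow> (\<forall>x\<in>B. a * x \<in> N \<longrightarrow> x \<in> N) \<and>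
     (\<exists>N'. is_ideal N' \<and> N \<subseteq> N' \<and> (\<forall>x\<in>B. a * x \<in> N') \<and> separating B z as N')"

text \<open>
  In a relation modulo \<open>N\<close> among the products \<open>power_prod as e * z\<close> let \<open>m\<close> be the least exponent
  of the first element \<open>a\<close>. Since \<open>a\<close> is a nonzerodivisor, \<open>a ^ m\<close> can be cancelled. The terms
  that are still divisible by \<open>a\<close> vanish modulo the next ideal, so the terms with exponent exactly
  \<open>m\<close> form a relation for the shorter list modulo that ideal. At the end a unit multiple of \<open>z\<close>
  would have to lie in the last ideal.
\<close>
lemma separating_independent:
  assumes "separating B z as N" "is_ideal N" "is_ideal B" "z \<in> B"
    and "finite E" "E \<noteq> {}" "\<And>e. e \<in> E \<Longrightarrow> length e = length as" "\<And>e. e \<in> E \<Longrightarrow> c e dvd 1"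
  shows "(\<Sum>e\<in>E. c e * power_prod as e) * z \<notin> N"
  using assms(1,2,5-)
proof (induction as arbitrary: N E c)
  case Nil
  then have "E = {[]}" by auto
  then have "c [] dvd 1" using Nil by auto
  then obtain d where d: "1 = c [] * d" by (auto elim: dvdE)
  show ?case
  proof
    assume "(\<Sum>e\<in>E. c e * power_prod [] e) * z \<in> N"
    then have "c [] * z \<in> N" using \<open>E = {[]}\<close> by simp
    then have "d * (c [] * z) \<in> N" using is_ideal_mult[OF Nil(2)] by blast
    also have "d * (c [] * z) = z" using d by (metis mult.assoc mult.commute mult_1)
    finally show False using Nil by simp
  qed
next
  case (Cons a as)
  from Cons.prems(1) obtain N' where N': "is_ideal N'" "N \<subseteq> N'" "\<forall>x\<in>B. a * x \<in> N'" "separating B z as N'"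
    and reg: "\<And>x. x \<in> B \<Longrightarrow> a * x \<in> N \<Longrightarrow> x \<in> N" by auto
  have reg_pow: "a ^ m * x \<in> N \<Longrightarrow> x \<in> N" if "x \<in> B" for m x
  proof (induction m)
    case (Suc m)
    then have "a * (a ^ m * x) \<in> N" by (simp add: mult.assoc)
    then have "a ^ m * x \<in> N" using reg is_ideal_mult[OF assms(3) that] by blast
    then show ?case by (rule Suc.IH)
  qed simp
  define m where "m = Min (hd ` E)"
  define F where "F = {e \<in> E. hd e = m}"
  have hd_ge: "m \<le> hd e" if "e \<in> E" for e
    using that Cons.prems unfolding m_def by simp
  have shape: "e = hd e # tl e \<and> length (tl e) = length as" if "e \<in> E" for e
    using Cons.prems(5)[OF that] by (cases e) auto
  have "m \<in> hd ` E" unfolding m_def using Cons.prems by (intro Min_in) auto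
  then have F: "F \<noteq> {}" "finite F" "F \<subseteq> E" using Cons.prems by (auto simp: F_def)
  have inj: "inj_on tl F"
    unfolding inj_on_def F_def using shape by (metis (mono_tags, lifting) mem_Collect_eq)
  define S where "S = (\<Sum>e\<in>tl ` F. c (m # e) * power_prod as e)"
  have S: "S = (\<Sum>e\<in>F. c e * power_prod as (tl e))"
    unfolding S_def sum.reindex[OF inj] o_def
  proof (rule sum.cong)
    fix e assume "e \<in> F"
    then have "m # tl e = e" using shape[of e] by (auto simp: F_def)
    then show "c (m # tl e) * power_prod as (tl e) = c e * power_prod as (tl e)" by simp
  qed simp
  have nS: "S * z \<notin> N'"
    unfolding S_def
  proof (rule Cons.IH[OF N'(4,1)])
    fix e assume "e \<in> tl ` F"
    then obtain e' where e': "e' \<in> F" "e = tl e'" by auto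
    then have "m # e = e'" "e' \<in> E" using shape[of e'] by (auto simp: F_def)
    then show "c (m # e) dvd 1" "length e = length as" using Cons.prems(6) shape[of e'] e' by auto
  qed (use F in auto)
  show ?case
  proof
    assume *: "(\<Sum>e\<in>E. c e * power_prod (a # as) e) * z \<in> N"
    define T where "T = (\<Sum>e\<in>E. c e * (a ^ (hd e - m) * power_prod as (tl e)))"
    have "(\<Sum>e\<in>E. c e * power_prod (a # as) e) = a ^ m * T"
      unfolding T_def sum_distrib_left
    proof (rule sum.cong)
      fix e assume e: "e \<in> E"
      have "power_prod (a # as) e = a ^ hd e * power_prod as (tl e)"
        using shape[OF e] by (metis power_prod.simps(1))
      also have "a ^ hd e = a ^ m * a ^ (hd e - m)"
        using hd_ge[OF e] by (simp flip: power_add)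
      finally show "c e * power_prod (a # as) e = a ^ m * (c e * (a ^ (hd e - m) * power_prod as (tl e)))"
        by (simp add: ac_simps)
    qed simp
    then have "a ^ m * (T * z) \<in> N" using * by (simp add: mult.assoc)
    then have T: "T * z \<in> N'"
      using reg_pow is_ideal_mult[OF assms(3,4)] N'(2) by blast
    have "T = (\<Sum>e\<in>E - F. c e * (a ^ (hd e - m) * power_prod as (tl e))) + S"
      unfolding T_def S using Cons.prems(3) F(3)
      by (subst sum.subset_diff[of F E]) (auto simp: F_def intro!: sum.cong)
    then have "T * z = (\<Sum>e\<in>E - F. c e * (a ^ (hd e - m) * power_prod as (tl e)) * z) + S * z"
      by (simp add: distrib_right sum_distrib_right)
    moreover have rest: "(\<Sum>e\<in>E - F. c e * (a ^ (hd e - m) * power_prod as (tl e)) * z) \<in> N'"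
    proof (rule is_ideal_sum[OF N'(1)])
      fix e assume "e \<in> E - F"
      then have "m < hd e" using hd_ge[of e] by (auto simp: F_def)
      then obtain k where k: "hd e - m = Suc k" by (metis Suc_diff_Suc)
      have "c e * (a ^ (hd e - m) * power_prod as (tl e)) * z =
          a * (c e * a ^ k * power_prod as (tl e) * z)"
        by (simp add: k ac_simps)
      then show "c e * (a ^ (hd e - m) * power_prod as (tl e)) * z \<in> N'"
        using N'(3) is_ideal_mult[OF assms(3,4)] by simp
    qed
    ultimately have "S * z \<in> N'"
      using is_ideal_diff[OF N'(1) T rest] by simp
    then show False using nS by simp
  qed
qed

lemma reg_seq_imp_separating:
  assumes "reg_seq A B fs" "is_ideal A" "is_ideal B" "A \<subseteq> B"
  shows "\<exists>z\<in>B. separating B z fs A"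
  using assms
proof (induction fs arbitrary: A)
  case (Cons f fs)
  then obtain z where z: "z \<in> B" "separating B z fs (adjoin A B f)"
    using is_ideal_adjoin adjoin_subset by (metis reg_seq.simps(2))
  then show ?case
    using Cons.prems is_ideal_adjoin[OF Cons.prems(2,3)] subset_adjoin[OF Cons.prems(3), of A f]
      mult_in_adjoin[OF Cons.prems(2)]
    unfolding separating.simps
    by (intro bexI[of _ z] conjI exI[of _ "adjoin A B f"] ballI) simp_all
qed auto

text \<open>
  A prime \<open>P i\<close> makes every element outside it a nonzerodivisor, and an element of \<open>P (Suc i)\<close>
  annihilates the ring modulo \<open>P (Suc i)\<close>.
\<close>
lemma prime_chain_imp_separating:
  assumes "\<And>i. i \<le> k \<Longrightarrow> is_prime (P i)" "\<And>i. i < k \<Longrightarrow> P i \<subset> P (Suc i)"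
  shows "\<exists>as. length as = k \<and> separating UNIV 1 as (P 0)"
proof -
  have "\<forall>i. \<exists>a. i < k \<longrightarrow> a \<in> P (Suc i) - P i" using assms(2) by blast
  then obtain a where a: "\<And>i. i < k \<Longrightarrow> a i \<in> P (Suc i) - P i" by metis
  have "separating UNIV 1 (map a [i..<k]) (P i)" if "i \<le> k" for i
    using that
  proof (induction rule: inc_induct)
    case base
    then show ?case using assms(1)[of k] by (simp add: is_prime_def)
  next
    case (step i)
    have "separating UNIV 1 (a i # map a [Suc i..<k]) (P i)"
      using a[of i] assms(1)[of i] assms(1)[of "Suc i"] assms(2)[of i] step
      by (auto simp: is_prime_def intro!: exI[of _ "P (Suc i)"] is_ideal_mult_right)
    then show ?case using step by (simp add: upt_conv_Cons)
  qed
  from this[of 0] show ?thesis by (intro exI[of _ "map a [0..<k]"]) auto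
qed


section \<open>Counting monomials bounds dimension and depth\<close>

text \<open>
  Gaussian elimination of one equation at a time.
\<close>
lemma exists_linear_relation:
  fixes v :: "'i \<Rightarrow> 's \<Rightarrow> 'k::field"
  assumes "finite S" "finite I" "card S < card I"
  shows "\<exists>c. (\<exists>i\<in>I. c i \<noteq> 0) \<and> (\<forall>s\<in>S. (\<Sum>i\<in>I. c i * v i s) = 0)"
  using assms
proof (induction S arbitrary: I v rule: finite_induct)
  case empty
  then have "I \<noteq> {}" by auto
  then show ?case by (intro exI[of _ "\<lambda>_. 1"]) auto
next
  case (insert s S)
  show ?case
  proof (cases "\<exists>j\<in>I. v j s \<noteq> 0")
    case False
    have "card S < card I" using insert by simp
    from insert.IH[OF insert.prems(1) this, of v] obtain c where
      "\<exists>i\<in>I. c i \<noteq> 0" "\<forall>t\<in>S. (\<Sum>i\<in>I. c i * v i t) = 0" by blast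
    moreover have "(\<Sum>i\<in>I. c i * v i s) = 0" using False by simp
    ultimately show ?thesis by blast
  next
    case True
    then obtain j where j: "j \<in> I" "v j s \<noteq> 0" by auto
    \<comment> \<open>The pivot row \<open>v j\<close> clears the entries at \<open>s\<close>.\<close>
    define w where "w = (\<lambda>i t. v i t - v i s / v j s * v j t)"
    have "card S < card (I - {j})" using insert j by simp
    from insert.IH[OF _ this, of w] insert.prems(1) obtain c where
      c: "\<exists>i\<in>I - {j}. c i \<noteq> 0" "\<And>t. t \<in> S \<Longrightarrow> (\<Sum>i\<in>I - {j}. c i * w i t) = 0"
      by auto
    define a where "a = - (\<Sum>i\<in>I - {j}. c i * (v i s / v j s))"
    define d where "d = c(j := a)"
    have expand: "(\<Sum>i\<in>I. d i * v i t) = (\<Sum>i\<in>I - {j}. c i * w i t)" for t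
    proof -
      have "(\<Sum>i\<in>I. d i * v i t) = d j * v j t + (\<Sum>i\<in>I - {j}. d i * v i t)"
        using j insert.prems(1) by (simp add: sum.remove)
      also have "(\<Sum>i\<in>I - {j}. d i * v i t) = (\<Sum>i\<in>I - {j}. c i * v i t)"
        by (intro sum.cong) (auto simp: d_def)
      also have "d j * v j t = (\<Sum>i\<in>I - {j}. - (c i * (v i s / v j s) * v j t))"
        by (simp add: d_def a_def sum_distrib_right sum_negf)
      finally show ?thesis
        by (simp add: w_def algebra_simps flip: sum.distrib)
    qed
    have "w i s = 0" for i using j by (simp add: w_def)
    then have "\<forall>t\<in>insert s S. (\<Sum>i\<in>I. d i * v i t) = 0"
      using c(2) by (simp add: expand)
    moreover have "\<exists>i\<in>I. d i \<noteq> 0" using c(1) by (auto simp: d_def)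
    ultimately show ?thesis by blast
  qed
qed

abbreviation lookup where "lookup \<equiv> Poly_Mapping.lookup"
abbreviation keys where "keys \<equiv> Poly_Mapping.keys"
abbreviation single where "single \<equiv> Poly_Mapping.single"

definition exponents_bounded :: "nat \<Rightarrow> ('v, 'k::field) mpoly \<Rightarrow> bool" where
  "exponents_bounded D p \<longleftrightarrow> (\<forall>u\<in>keys p. \<forall>i. lookup u i \<le> D)"

lemma exponents_bounded_mult:
  assumes "exponents_bounded D p" "exponents_bounded D' q"
  shows "exponents_bounded (D + D') (p * q)"
  unfolding exponents_bounded_def
proof (intro ballI allI)
  fix u i assume "u \<in> keys (p * q)"
  then obtain a b where "u = a + b" "a \<in> keys p" "b \<in> keys q" using keys_mult by blast
  then show "lookup u i \<le> D + D'"
    using assms by (simp add: exponents_bounded_def lookup_add add_mono)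
qed

lemma exponents_bounded_one: "exponents_bounded D 1"
  by (simp add: exponents_bounded_def)

lemma exponents_bounded_power:
  assumes "exponents_bounded D p"
  shows "exponents_bounded (n * D) (p ^ n)"
  by (induction n) (auto intro!: exponents_bounded_mult assms simp: exponents_bounded_one)

lemma exponents_bounded_mono: "exponents_bounded D p \<Longrightarrow> D \<le> D' \<Longrightarrow> exponents_bounded D' p"
  by (auto simp: exponents_bounded_def intro: order_trans)

lemma exponents_bounded_exists:
  fixes p :: "('v::finite, 'k::field) mpoly"
  shows "\<exists>D. exponents_bounded D p"
proof
  let ?X = "(\<lambda>(u, i). lookup u i) ` (keys p \<times> UNIV)"
  have "lookup u i \<le> Max ?X" if "u \<in> keys p" for u i
    using that by (intro Max_ge) auto
  then show "exponents_bounded (Max ?X) p" by (simp add: exponents_bounded_def)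
qed

lemma exponents_bounded_exists_list:
  fixes as :: "('v::finite, 'k::field) mpoly list"
  shows "\<exists>D. \<forall>a\<in>set as. exponents_bounded D a"
proof (induction as)
  case (Cons a as)
  then obtain D D' where "\<forall>a\<in>set as. exponents_bounded D a" "exponents_bounded D' a"
    using exponents_bounded_exists by blast
  then show ?case
    by (intro exI[of _ "max D D'"]) (auto intro: exponents_bounded_mono)
qed auto

lemma exponents_bounded_power_prod:
  assumes "\<And>a. a \<in> set as \<Longrightarrow> exponents_bounded D a" "set es \<subseteq> {..<T}"
  shows "exponents_bounded (length as * T * D) (power_prod as es)"
  using assms
proof (induction as es rule: power_prod.induct)
  case (1 a as e es)
  have "exponents_bounded (T * D) (a ^ e)"
    using exponents_bounded_power[of D a e] 1 by (auto intro: exponents_bounded_mono)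
  with 1 show ?case by (simp add: exponents_bounded_mult add_mult_distrib)
qed (auto simp: exponents_bounded_one)

lemma card_monomials_supported:
  fixes V :: "'v::finite set" and M :: nat
  defines "S \<equiv> {u :: 'v mono. keys u \<subseteq> V \<and> (\<forall>i. lookup u i \<le> M)}"
  shows "finite S" "card S \<le> (M + 1) ^ card V"
proof -
  let ?f = "\<lambda>u::'v mono. restrict (lookup u) V"
  have inj: "inj_on ?f S"
  proof (rule inj_onI)
    fix u w assume uw: "u \<in> S" "w \<in> S" "?f u = ?f w"
    show "u = w"
    proof (rule poly_mapping_eqI)
      fix k show "lookup u k = lookup w k"
      proof (cases "k \<in> V")
        case True
        then show ?thesis using fun_cong[OF uw(3), of k] by simp
      next
        case False
        then have "k \<notin> keys u" "k \<notin> keys w" using uw by (auto simp: S_def)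
        then show ?thesis by (simp add: in_keys_iff)
      qed
    qed
  qed
  have sub: "?f ` S \<subseteq> PiE V (\<lambda>_. {..M})" by (auto simp: S_def)
  have fin: "finite (PiE V (\<lambda>_. {..M}))" by (intro finite_PiE) auto
  show "finite S" using inj sub fin by (metis finite_imageD finite_subset)
  have "card S = card (?f ` S)" using inj by (simp add: card_image)
  also have "\<dots> \<le> card (PiE V (\<lambda>_. {..M}))" using sub fin by (rule card_mono[rotated])
  also have "\<dots> = (M + 1) ^ card V" by (simp add: card_PiE)
  finally show "card S \<le> (M + 1) ^ card V" .
qed

lemma card_standard_monomials:
  fixes \<V> :: "'v::finite set set" and M :: nat
  assumes "\<And>V. V \<in> \<V> \<Longrightarrow> card V \<le> n"
  defines "S \<equiv> {u :: 'v mono. (\<exists>V\<in>\<V>. keys u \<subseteq> V) \<and> (\<forall>i. lookup u i \<le> M)}"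
  shows "finite S" "card S \<le> card \<V> * (M + 1) ^ n"
proof -
  let ?S = "\<lambda>V. {u :: 'v mono. keys u \<subseteq> V \<and> (\<forall>i. lookup u i \<le> M)}"
  have S: "S = (\<Union>V\<in>\<V>. ?S V)" by (auto simp: S_def)
  show "finite S" unfolding S by (intro finite_UN_I card_monomials_supported(1)) simp
  have "card S \<le> (\<Sum>V\<in>\<V>. card (?S V))" unfolding S by (intro card_UN_le) auto
  also have "\<dots> \<le> (\<Sum>V\<in>\<V>. (M + 1) ^ n)"
  proof (rule sum_mono)
    fix V assume "V \<in> \<V>"
    have "card (?S V) \<le> (M + 1) ^ card V" by (rule card_monomials_supported)
    also have "\<dots> \<le> (M + 1) ^ n" using assms(1)[OF \<open>V \<in> \<V>\<close>] by (intro power_increasing) auto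
    finally show "card (?S V) \<le> (M + 1) ^ n" .
  qed
  finally show "card S \<le> card \<V> * (M + 1) ^ n" by simp
qed

lemma lookup_const_mult:
  fixes p :: "('v, 'k::field) mpoly"
  shows "lookup (single 0 c * p) u = c * lookup p u"
  by (simp only: lookup_mult lookup_single when_mult Sum_any_when_equal') simp

text \<open>
  Suppose that, modulo \<open>N\<close>, elements of \<open>B\<close> are determined by their coefficients at monomials in
  at most \<open>n\<close> variables (with finitely many choices of these variables). A separating list of
  length \<open>k\<close> has \<open>T ^ k\<close> products of powers with exponents below \<open>T\<close>; their exponents in the
  variables are of order \<open>T\<close>, so only of order \<open>T ^ n\<close> coefficients matter. If \<open>k > n\<close>, then for
  large \<open>T\<close> linear algebra yields a relation modulo \<open>N\<close>, which independence forbids.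
\<close>
lemma separating_length_le:
  fixes as :: "('v::finite, 'k::field) mpoly list"
  assumes sep: "separating B z as N" and N: "is_ideal N" and B: "is_ideal B" "z \<in> B"
    and \<V>: "\<And>V. V \<in> \<V> \<Longrightarrow> card V \<le> n"
    and std: "\<And>p. p \<in> B \<Longrightarrow> (\<And>u V. u \<in> keys p \<Longrightarrow> V \<in> \<V> \<Longrightarrow> \<not> keys u \<subseteq> V) \<Longrightarrow> p \<in> N"
  shows "length as \<le> n"
proof (rule ccontr)
  assume "\<not> length as \<le> n"
  then have len: "n + 1 \<le> length as" by simp
  let ?k = "length as"
  obtain D where D: "\<forall>a\<in>set (z # as). exponents_bounded D a"
    using exponents_bounded_exists_list by blast
  \<comment> \<open>All relevant exponents are at most \<open>M\<close>, and \<open>M + 1 \<le> C * T\<close>; the choice of \<open>T\<close> makes \<open>card \<V> * (C * T) ^ n\<close> smaller than \<open>T ^ (n + 1)\<close>.\<close>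
  define C where "C = ?k * D + D + 1"
  define T where "T = card \<V> * C ^ n + 1"
  define M where "M = ?k * T * D + D"
  define E where "E = {es. set es \<subseteq> {..<T} \<and> length es = ?k}"
  define S where "S = {u :: 'v mono. (\<exists>V\<in>\<V>. keys u \<subseteq> V) \<and> (\<forall>i. lookup u i \<le> M)}"
  have "M + 1 \<le> C * T"
    unfolding M_def C_def T_def by (simp add: algebra_simps)
  then have "(M + 1) ^ n \<le> (C * T) ^ n" by (intro power_mono) auto
  then have "card S \<le> card \<V> * (C * T) ^ n"
    using card_standard_monomials(2)[of \<V> n M] \<V> unfolding S_def
    by (meson mult_le_mono2 order_trans)
  also have "card \<V> * (C * T) ^ n = (card \<V> * C ^ n) * T ^ n"
    by (simp add: power_mult_distrib)
  also have "\<dots> < T * T ^ n"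
  proof (rule mult_strict_right_mono)
    show "card \<V> * C ^ n < T" "0 < T ^ n" by (simp_all add: T_def)
  qed
  also have "\<dots> \<le> T ^ ?k"
    using power_increasing[of "n + 1" ?k T] len by (simp add: T_def)
  also have "\<dots> = card E" unfolding E_def by (simp add: card_lists_length_eq)
  finally have card: "card S < card E" .
  have fin: "finite E" unfolding E_def by (intro finite_lists_length_eq) auto
  have finS: "finite S" unfolding S_def using card_standard_monomials(1)[of \<V> n M] \<V> by blast
  obtain c where c: "\<exists>e\<in>E. c e \<noteq> 0" "\<And>u. u \<in> S \<Longrightarrow> (\<Sum>e\<in>E. c e * lookup (power_prod as e * z) u) = 0"
    using exists_linear_relation[OF finS fin card, of "\<lambda>e u. lookup (power_prod as e * z) u"] by blast
  define E' where "E' = {e \<in> E. c e \<noteq> 0}"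
  define p where "p = (\<Sum>e\<in>E'. single 0 (c e) * power_prod as e) * z"
  have p: "p = (\<Sum>e\<in>E'. single 0 (c e) * (power_prod as e * z))"
    by (simp add: p_def sum_distrib_right mult.assoc)
  have lookup_p: "lookup p u = (\<Sum>e\<in>E. c e * lookup (power_prod as e * z) u)" for u
    unfolding p lookup_sum lookup_const_mult E'_def using fin
    by (intro sum.mono_neutral_left) auto
  have "p \<notin> N"
    unfolding p_def
  proof (rule separating_independent[OF sep N B])
    fix e assume e: "e \<in> E'"
    then have "single 0 (c e) * single 0 (inverse (c e)) = (1 :: ('v, 'k) mpoly)"
      by (simp add: mult_single E'_def)
    then show "single 0 (c e) dvd (1 :: ('v, 'k) mpoly)" by (metis dvdI)
    show "length e = length as" using e by (simp add: E'_def E_def)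
  qed (use fin c(1) in \<open>auto simp: E'_def\<close>)
  moreover have "p \<in> N"
  proof (rule std)
    show "p \<in> B" unfolding p_def using B by (rule is_ideal_mult)
    fix u V assume u: "u \<in> keys p" and V: "V \<in> \<V>"
    show "\<not> keys u \<subseteq> V"
    proof
      assume "keys u \<subseteq> V"
      have "lookup p u \<noteq> 0" using u by (simp add: in_keys_iff)
      then obtain e where e: "e \<in> E" "lookup (power_prod as e * z) u \<noteq> 0"
        unfolding lookup_p by (metis (no_types, lifting) mult_zero_right sum.neutral)
      have "exponents_bounded M (power_prod as e * z)"
        unfolding M_def using e(1) D
        by (intro exponents_bounded_mult exponents_bounded_power_prod) (auto simp: E_def)
      then have "\<forall>i. lookup u i \<le> M" using e(2) by (simp add: exponents_bounded_def in_keys_iff)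
      then have "u \<in> S" using V \<open>keys u \<subseteq> V\<close> by (auto simp: S_def)
      then show False using c(2) \<open>lookup p u \<noteq> 0\<close> by (simp add: lookup_p)
    qed
  qed
  ultimately show False by simp
qed

lemma subq_depth_le:
  fixes A :: "('v::finite, 'k::field) mpoly set"
  assumes "is_ideal A" "is_ideal B" "A \<subseteq> B"
    and "\<And>V. V \<in> \<V> \<Longrightarrow> card V \<le> n"
    and "\<And>p. p \<in> B \<Longrightarrow> (\<And>u V. u \<in> keys p \<Longrightarrow> V \<in> \<V> \<Longrightarrow> \<not> keys u \<subseteq> V) \<Longrightarrow> p \<in> A"
  shows "subq_depth \<mm> A B \<le> enat n"
  unfolding subq_depth_def
proof (rule Sup_least, clarify)
  fix fs assume "reg_seq A B fs"
  then obtain z where "z \<in> B" "separating B z fs A"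
    using reg_seq_imp_separating assms(1-3) by blast
  then show "enat (length fs) \<le> enat n"
    using separating_length_le[of B z fs A \<V> n] assms by auto
qed

lemma subq_dim_le:
  fixes A :: "('v::finite, 'k::field) mpoly set"
  assumes "\<And>V. V \<in> \<V> \<Longrightarrow> card V \<le> n"
    and "\<And>p b. (\<And>u V. u \<in> keys p \<Longrightarrow> V \<in> \<V> \<Longrightarrow> \<not> keys u \<subseteq> V) \<Longrightarrow> b \<in> B \<Longrightarrow> p * b \<in> A"
  shows "subq_dim A B \<le> enat n"
  unfolding subq_dim_def
proof (rule Sup_least, clarify)
  fix k and P :: "nat \<Rightarrow> ('v, 'k) mpoly set"
  assume P: "\<forall>i\<le>k. is_prime (P i) \<and> {r. \<forall>b\<in>B. r * b \<in> A} \<subseteq> P i" "\<forall>i<k. P i \<subset> P (Suc i)"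
  then obtain as where as: "length as = k" "separating UNIV 1 as (P 0)"
    using prime_chain_imp_separating[of k P] by auto
  have "length as \<le> n"
  proof (rule separating_length_le[OF as(2) _ is_ideal_UNIV UNIV_I assms(1)])
    show "is_ideal (P 0)" using P by (simp add: is_prime_def)
    fix p :: "('v, 'k) mpoly"
    assume "\<And>u V. u \<in> keys p \<Longrightarrow> V \<in> \<V> \<Longrightarrow> \<not> keys u \<subseteq> V"
    then have "\<forall>b\<in>B. p * b \<in> A" using assms(2) by blast
    then show "p \<in> P 0" using P(1) by blast
  qed
  then show "enat k \<le> enat n" using as by simp
qed


section \<open>Monomial and Stanley-Reisner ideals\<close>

definition restr :: "'v mono set \<Rightarrow> ('v, 'k::field) mpoly \<Rightarrow> ('v, 'k) mpoly" where
  "restr T p = (\<Sum>u\<in>keys p \<inter> T. single u (lookup p u))"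

lemma lookup_restr: "lookup (restr T p) u = (if u \<in> T then lookup p u else 0)"
  unfolding restr_def lookup_sum lookup_single when_def
  by (auto simp: in_keys_iff)

lemma keys_restr: "keys (restr T p) = keys p \<inter> T"
  by (auto simp: in_keys_iff lookup_restr split: if_splits)

lemma restr_split: "restr T p + restr (- T) p = p"
  by (intro poly_mapping_eqI) (simp add: lookup_add lookup_restr)

lemma poly_eq_sum_terms:
  fixes p :: "('v, 'k::field) mpoly"
  shows "p = (\<Sum>u\<in>keys p. single u (lookup p u))"
proof -
  have "restr UNIV p = p" by (intro poly_mapping_eqI) (simp add: lookup_restr)
  then show ?thesis by (simp add: restr_def)
qed

lemma mem_ideal_by_terms:
  fixes I :: "('v, 'k::field) mpoly set"
  assumes "is_ideal I" "\<And>u. u \<in> keys p \<Longrightarrow> single u (lookup p u) \<in> I"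
  shows "p \<in> I"
  using is_ideal_sum[OF assms(1), of "keys p" "\<lambda>u. single u (lookup p u)"] assms(2)
  by (simp flip: poly_eq_sum_terms)

lemma keys_mono_add: "keys (u + w :: 'v mono) = keys u \<union> keys w"
  by (auto simp: in_keys_iff lookup_add)

lemma is_ideal_monomials:
  assumes "\<And>u w. u \<in> U \<Longrightarrow> u + w \<in> U"
  shows "is_ideal {p :: ('v, 'k::field) mpoly. keys p \<subseteq> U}"
proof (rule is_idealI)
  fix x y :: "('v, 'k) mpoly" assume "x \<in> {p. keys p \<subseteq> U}" "y \<in> {p. keys p \<subseteq> U}"
  then show "x + y \<in> {p. keys p \<subseteq> U}" using keys_add[of x y] by blast
next
  fix r x :: "('v, 'k) mpoly" assume x: "x \<in> {p. keys p \<subseteq> U}"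
  have "u \<in> U" if "u \<in> keys (r * x)" for u
  proof -
    from that obtain a b where "u = a + b" "a \<in> keys r" "b \<in> keys x" using keys_mult by blast
    then show ?thesis using assms[of b a] x by (auto simp: add.commute)
  qed
  then show "r * x \<in> {p. keys p \<subseteq> U}" by blast
qed simp

lemma monomial_span_ideal_eq:
  "(monomial_span_ideal S :: ('v, 'k::field) mpoly set) = {p. \<forall>u\<in>keys p. \<exists>s\<in>S. mono_dvd s u}"
proof -
  let ?R = "mpoly_ring :: ('v, 'k) mpoly ring"
  let ?U = "{u. \<exists>s\<in>S. mono_dvd s u}"
  let ?I = "{p :: ('v, 'k) mpoly. keys p \<subseteq> ?U}"
  interpret cring ?R by (rule cring_from_type_algebra)
  have I: "is_ideal ?I"
    by (rule is_ideal_monomials) (simp add: mono_dvd_def, metis add.assoc)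
  have "monomial_poly ` S \<subseteq> ?I"
    by (auto simp: monomial_poly_def mono_dvd_def intro!: bexI exI[of _ 0])
  then have "Idl\<^bsub>?R\<^esub> (monomial_poly ` S) \<subseteq> ?I"
    using I by (intro genideal_minimal) (auto simp: ideal_type_ring_iff)
  moreover have "p \<in> Idl\<^bsub>?R\<^esub> (monomial_poly ` S)" if p: "p \<in> ?I" for p
  proof (rule mem_ideal_by_terms)
    show G: "is_ideal (Idl\<^bsub>?R\<^esub> (monomial_poly ` S))"
      using genideal_ideal[of "monomial_poly ` S"] by (simp add: ideal_type_ring_iff)
    fix u assume "u \<in> keys p"
    then obtain s w where s: "s \<in> S" "u = s + w" using p by (auto simp: mono_dvd_def)
    then have "monomial_poly s \<in> Idl\<^bsub>?R\<^esub> (monomial_poly ` S)"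
      using genideal_self[of "monomial_poly ` S"] by auto
    then have "single w (lookup p u) * monomial_poly s \<in> Idl\<^bsub>?R\<^esub> (monomial_poly ` S)"
      by (rule is_ideal_mult[OF G])
    then show "single u (lookup p u) \<in> Idl\<^bsub>?R\<^esub> (monomial_poly ` S)"
      by (simp add: monomial_poly_def mult_single s(2) add.commute)
  qed
  ultimately show ?thesis unfolding monomial_span_ideal_def by blast
qed

text \<open>
  For a simplicial complex \<open>\<Delta>\<close> (a downset) this is its Stanley-Reisner ideal. Describing it by the
  monomials that occur turns unions and intersections of complexes into intersections and sums of
  ideals.
\<close>
definition sr_ideal :: "'v set set \<Rightarrow> ('v, 'k::field) mpoly set" where
  "sr_ideal \<Delta> = {p. \<forall>u\<in>keys p. keys u \<notin> \<Delta>}"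

definition downset :: "'v set set \<Rightarrow> bool" where
  "downset \<Delta> \<longleftrightarrow> (\<forall>F\<in>\<Delta>. \<forall>G\<subseteq>F. G \<in> \<Delta>)"

text \<open>
  The prime generated by the variables outside \<open>V\<close>.
\<close>
abbreviation face_prime :: "'v set \<Rightarrow> ('v, 'k::field) mpoly set" where
  "face_prime V \<equiv> sr_ideal (Pow V)"

definition var :: "'v \<Rightarrow> ('v, 'k::field) mpoly" where
  "var i = single (single i 1) 1"

lemma downset_Pow: "downset (Pow V)" and downset_Un: "downset \<Delta> \<Longrightarrow> downset \<Gamma> \<Longrightarrow> downset (\<Delta> \<union> \<Gamma>)"
  and downset_Int: "downset \<Delta> \<Longrightarrow> downset \<Gamma> \<Longrightarrow> downset (\<Delta> \<inter> \<Gamma>)"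
  and downset_UN: "(\<And>i. i \<in> S \<Longrightarrow> downset (\<Theta> i)) \<Longrightarrow> downset (\<Union>i\<in>S. \<Theta> i)"
  unfolding downset_def by blast+

lemma is_ideal_sr_ideal:
  assumes "downset \<Delta>"
  shows "is_ideal (sr_ideal \<Delta> :: ('v, 'k::field) mpoly set)"
proof -
  have "is_ideal {p :: ('v, 'k) mpoly. keys p \<subseteq> {u. keys u \<notin> \<Delta>}}"
    using assms by (intro is_ideal_monomials) (auto simp: downset_def keys_mono_add)
  then show ?thesis by (simp add: sr_ideal_def subset_iff Ball_def)
qed

lemma sr_ideal_antimono: "\<Delta> \<subseteq> \<Gamma> \<Longrightarrow> sr_ideal \<Gamma> \<subseteq> sr_ideal \<Delta>"
  by (auto simp: sr_ideal_def)

lemma sr_ideal_Un: "sr_ideal (\<Delta> \<union> \<Gamma>) = sr_ideal \<Delta> \<inter> sr_ideal \<Gamma>"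
  by (auto simp: sr_ideal_def)

text \<open>
  The ideal of an intersection of two complexes is the sum of their ideals.
\<close>
lemma sr_ideal_Int_split:
  assumes "p \<in> sr_ideal (\<Delta> \<inter> \<Gamma>)"
  shows "\<exists>a\<in>sr_ideal \<Delta>. \<exists>b\<in>sr_ideal \<Gamma>. p = a + b"
proof (intro bexI)
  let ?T = "{u. keys u \<notin> \<Delta>}"
  show "p = restr ?T p + restr (- ?T) p" by (simp add: restr_split)
qed (use assms in \<open>auto simp: sr_ideal_def keys_restr\<close>)

lemma var_mem_sr_ideal: "var i \<in> sr_ideal \<Delta> \<longleftrightarrow> {i} \<notin> \<Delta>"
  by (simp add: sr_ideal_def var_def)

text \<open>
  Discarding all monomials that are not supported in \<open>V\<close> is a ring homomorphism onto the
  polynomial ring in the variables of \<open>V\<close>, which is a domain, and \<open>face_prime V\<close> is its kernel.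
\<close>
lemma is_prime_face_prime:
  "is_prime (face_prime V :: ('v::linorder, 'k::field) mpoly set)"
proof -
  let ?P = "face_prime V :: ('v, 'k) mpoly set"
  let ?T = "{u :: 'v mono. keys u \<subseteq> V}"
  have P: "is_ideal ?P" by (rule is_ideal_sr_ideal[OF downset_Pow])
  have rest: "restr (- ?T) p \<in> ?P" for p by (auto simp: sr_ideal_def keys_restr)
  have mem: "p \<in> ?P \<longleftrightarrow> restr ?T p = 0" for p :: "('v, 'k) mpoly"
  proof -
    have "restr ?T p = 0 \<longleftrightarrow> keys p \<inter> ?T = {}"
      by (metis keys_eq_empty keys_restr)
    then show ?thesis by (auto simp: sr_ideal_def)
  qed
  have "p * q \<notin> ?P" if "p \<notin> ?P" "q \<notin> ?P" for p q
  proof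
    let ?p = "restr ?T p" and ?q = "restr ?T q"
    assume "p * q \<in> ?P"
    have "p * q = ?p * q + restr (- ?T) p * q" by (metis restr_split distrib_right)
    also have "?p * q = ?p * ?q + ?p * restr (- ?T) q" by (metis restr_split distrib_left)
    finally have "p * q = ?p * ?q + (?p * restr (- ?T) q + q * restr (- ?T) p)"
      by (simp add: ac_simps)
    then have "?p * ?q = p * q - (?p * restr (- ?T) q + q * restr (- ?T) p)" by simp
    then have "?p * ?q \<in> ?P"
      using \<open>p * q \<in> ?P\<close> rest by (simp add: is_ideal_diff[OF P] is_ideal_add[OF P] is_ideal_mult[OF P])
    moreover have "keys u \<subseteq> V" if u: "u \<in> keys (?p * ?q)" for u
    proof -
      obtain a b where "u = a + b" "a \<in> keys ?p" "b \<in> keys ?q" using u keys_mult by blast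
      then show ?thesis by (auto simp: keys_restr keys_mono_add)
    qed
    ultimately have "keys (?p * ?q) = {}" unfolding sr_ideal_def by blast
    then have "?p * ?q = 0" by simp
    then show False using that mem by auto
  qed
  then show ?thesis using P by (auto simp: is_prime_def sr_ideal_def)
qed

lemma is_prime_mult_mem: "is_prime P \<Longrightarrow> f \<notin> P \<Longrightarrow> f * x \<in> P \<Longrightarrow> x \<in> P"
  by (auto simp: is_prime_def)

lemma mem_sr_ideal_iff_faces:
  assumes "downset \<Delta>"
  shows "p \<in> sr_ideal \<Delta> \<longleftrightarrow> (\<forall>V\<in>\<Delta>. p \<in> face_prime V)"
  using assms by (auto simp: sr_ideal_def downset_def)

lemma graded_maximal_ideal_eq: "graded_maximal_ideal = (sr_ideal {{}} :: ('v, 'k::field) mpoly set)"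
proof -
  have "(\<exists>i. mono_dvd (single i 1) u) \<longleftrightarrow> keys u \<noteq> {}" for u :: "'v mono"
  proof
    assume "\<exists>i. mono_dvd (single i 1) u"
    then obtain i w where "u = single i 1 + w" by (auto simp: mono_dvd_def)
    then have "i \<in> keys u" by (simp add: keys_mono_add)
    then show "keys u \<noteq> {}" by blast
  next
    assume "keys u \<noteq> {}"
    then obtain i where i: "i \<in> keys u" by blast
    have "u = single i 1 + (u - single i 1)"
      using i by (intro poly_mapping_eqI) (auto simp: lookup_add lookup_minus lookup_single when_def in_keys_iff)
    then show "\<exists>i. mono_dvd (single i 1) u" by (auto simp: mono_dvd_def)
  qed
  then show ?thesis
    by (auto simp: graded_maximal_ideal_def monomial_span_ideal_eq sr_ideal_def)
qed

section \<open>Dimension and depth of pure subquotients\<close>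

text \<open>
  Removing the elements of \<open>V\<close> one at a time gives a chain of face primes above the annihilator
  of \<open>B/A\<close>.
\<close>
lemma subq_dim_ge_face:
  fixes A :: "('v::{finite,linorder}, 'k::field) mpoly set"
  assumes "A \<subseteq> face_prime V" "b \<in> B" "b \<notin> face_prime V"
  shows "enat (card V) \<le> subq_dim A B"
proof -
  obtain xs where xs: "set xs = V" "distinct xs" using finite_distinct_list[of V] by auto
  define P where "P = (\<lambda>i. face_prime (set (drop i xs)) :: ('v, 'k) mpoly set)"
  have len: "length xs = card V" using xs by (metis distinct_card)
  have "is_prime (P i) \<and> {r. \<forall>b\<in>B. r * b \<in> A} \<subseteq> P i" for i
  proof
    show "is_prime (P i)" unfolding P_def by (rule is_prime_face_prime)
    have "face_prime V \<subseteq> P i"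
      unfolding P_def using xs set_drop_subset[of i xs] by (intro sr_ideal_antimono) auto
    moreover have "r \<in> face_prime V" if "\<forall>b\<in>B. r * b \<in> A" for r
    proof (rule is_prime_mult_mem[OF is_prime_face_prime assms(3)])
      show "b * r \<in> face_prime V" using that assms by (auto simp: mult.commute)
    qed
    ultimately show "{r. \<forall>b\<in>B. r * b \<in> A} \<subseteq> P i" by blast
  qed
  moreover have "P i \<subset> P (Suc i)" if "i < card V" for i
  proof
    have i: "drop i xs = xs ! i # drop (Suc i) xs" using that len by (simp add: Cons_nth_drop_Suc)
    show "P i \<subseteq> P (Suc i)" unfolding P_def i by (intro sr_ideal_antimono) auto
    have "xs ! i \<notin> set (drop (Suc i) xs)"
      using xs(2) distinct_drop[of xs i] unfolding i by simp
    then have "var (xs ! i) \<in> P (Suc i)" "var (xs ! i) \<notin> P i"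
      by (simp_all add: P_def var_mem_sr_ideal i del: drop_Suc)
    then show "P i \<noteq> P (Suc i)" by auto
  qed
  ultimately show ?thesis
    unfolding subq_dim_def by (intro Sup_upper) blast
qed

lemma subq_depth_ge:
  assumes "reg_seq A B fs" "set fs \<subseteq> \<mm>"
  shows "enat (length fs) \<le> subq_depth \<mm> A B"
  unfolding subq_depth_def using assms by (intro Sup_upper) blast

text \<open>
  If \<open>A\<close> is cut out of \<open>B\<close> by face primes, then modulo \<open>A\<close> an element of \<open>B\<close> is determined by its
  coefficients at the monomials supported in one of these faces, so the counting bound applies.
\<close>
lemma pure_subquotient:
  fixes A :: "('v::{finite,linorder}, 'k::field) mpoly set"
  assumes B: "is_ideal B" and A: "A = {b \<in> B. \<forall>V\<in>\<V>. b \<in> face_prime V}"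
    and card: "\<And>V. V \<in> \<V> \<Longrightarrow> card V \<le> n"
  shows "is_ideal A" "A \<subseteq> B" "subq_dim A B \<le> enat n" "subq_depth \<mm> A B \<le> enat n"
proof -
  have P: "is_ideal (face_prime V :: ('v, 'k) mpoly set)" for V
    using is_prime_face_prime by (auto simp: is_prime_def)
  show idA: "is_ideal A"
    unfolding A using B P by (auto simp: is_ideal_def)
  show "A \<subseteq> B" by (auto simp: A)
  show "subq_depth \<mm> A B \<le> enat n"
    using idA B \<open>A \<subseteq> B\<close> card
    by (rule subq_depth_le[where \<V> = \<V>]) (auto simp: A sr_ideal_def)
  show "subq_dim A B \<le> enat n"
    using card
  proof (rule subq_dim_le[where \<V> = \<V>])
    fix p b :: "('v, 'k) mpoly"
    assume p: "\<And>u V. u \<in> keys p \<Longrightarrow> V \<in> \<V> \<Longrightarrow> \<not> keys u \<subseteq> V" and b: "b \<in> B"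
    have "p \<in> face_prime V" if "V \<in> \<V>" for V using p that by (auto simp: sr_ideal_def)
    then show "p * b \<in> A"
      unfolding A using is_ideal_mult[OF B b] is_ideal_mult_right[OF P] by auto
  qed
qed

lemma nonzerodivisor_pure:
  fixes A :: "('v::{finite,linorder}, 'k::field) mpoly set"
  assumes "A = {b \<in> B. \<forall>V\<in>\<V>. b \<in> face_prime V}" "\<And>V. V \<in> \<V> \<Longrightarrow> f \<notin> face_prime V"
    and "x \<in> B" "f * x \<in> A"
  shows "x \<in> A"
  using assms is_prime_mult_mem[OF is_prime_face_prime] by blast

lemma mono_deg_pos:
  assumes "keys u \<noteq> {}"
  shows "1 \<le> mono_deg u"
proof -
  obtain i where "i \<in> keys u" using assms by blast
  then have "lookup u i > 0" by (simp add: in_keys_iff)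
  then have "mono_deg u > 0" unfolding mono_deg_def by (intro sum_pos2[of _ i]) auto
  then show ?thesis by simp
qed

text \<open>
  A monomial of the lowest degree occurring in \<open>B\<close> cannot occur in \<open>f B\<close> when \<open>f\<close> has no constant
  term. This graded form of Nakayama's lemma is what keeps \<open>A + f B\<close> different from \<open>B\<close>.
\<close>
lemma adjoin_avoids_lowest_degree:
  fixes A :: "('v::finite, 'k::field) mpoly set"
  assumes "\<And>b w. b \<in> B \<Longrightarrow> w \<in> keys b \<Longrightarrow> mono_deg u \<le> mono_deg w"
    and "f \<in> sr_ideal {{}}" "\<And>a. a \<in> A \<Longrightarrow> u \<notin> keys a" "x \<in> adjoin A B f"
  shows "u \<notin> keys x"
proof -
  from assms obtain a b where x: "a \<in> A" "b \<in> B" "x = a + f * b" by (auto simp: adjoin_def)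
  have "u \<notin> keys (f * b)"
  proof
    assume "u \<in> keys (f * b)"
    then obtain v w where vw: "u = v + w" "v \<in> keys f" "w \<in> keys b" using keys_mult by blast
    have "keys v \<noteq> {}" using vw assms(2) by (auto simp: sr_ideal_def)
    then have "1 \<le> mono_deg v" by (rule mono_deg_pos)
    moreover have "mono_deg u = mono_deg v + mono_deg w"
      by (simp add: mono_deg_def vw lookup_add sum.distrib)
    ultimately show False using assms(1)[OF x(2) vw(3)] by simp
  qed
  then show ?thesis using x assms(3) keys_add[of a "f * b"] by auto
qed


section \<open>Elementary symmetric polynomials on faces\<close>

text \<open>
  The first two elementary symmetric polynomials serve as parameters over every field: modulo the
  prime of an edge \<open>{i, j}\<close> they become \<open>x\<^sub>i + x\<^sub>j\<close> and \<open>x\<^sub>i x\<^sub>j\<close>. A system of linear forms that is good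
  for all edges need not exist over a small field.
\<close>
definition esym1 :: "('v::finite, 'k::field) mpoly" where
  "esym1 = (\<Sum>i\<in>UNIV. var i)"

definition esym2 :: "('v::finite, 'k::field) mpoly" where
  "esym2 = (\<Sum>E\<in>{E. card E = 2}. \<Prod>i\<in>E. var i)"

lemma is_ideal_face_prime: "is_ideal (face_prime V :: ('v, 'k::field) mpoly set)"
  by (rule is_ideal_sr_ideal[OF downset_Pow])

lemma esym1_minus_var: "esym1 - var i \<in> face_prime {i}"
proof -
  have "esym1 - var i = (\<Sum>j\<in>UNIV - {i}. var j)"
    by (simp add: esym1_def sum.remove[of UNIV i])
  also have "\<dots> \<in> face_prime {i}"
    by (rule is_ideal_sum[OF is_ideal_face_prime]) (auto simp: var_mem_sr_ideal)
  finally show ?thesis .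
qed

lemma esym1_not_in_face_prime:
  assumes "V \<noteq> {}"
  shows "(esym1 :: ('v::finite, 'k::field) mpoly) \<notin> face_prime V"
proof
  assume e: "(esym1 :: ('v, 'k) mpoly) \<in> face_prime V"
  obtain i where i: "i \<in> V" using assms by blast
  have "(esym1 :: ('v, 'k) mpoly) \<in> face_prime {i}"
    using e sr_ideal_antimono[of "Pow {i}" "Pow V"] i by auto
  then have "esym1 - (esym1 - var i) \<in> (face_prime {i} :: ('v, 'k) mpoly set)"
    using esym1_minus_var by (rule is_ideal_diff[OF is_ideal_face_prime])
  then show False by (simp add: var_mem_sr_ideal)
qed

lemma prod_var_in_ideal:
  fixes I :: "('v, 'k::field) mpoly set"
  assumes "is_ideal I" "finite E" "k \<in> E" "var k \<in> I"
  shows "(\<Prod>i\<in>E. var i) \<in> I"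
  using assms by (simp add: prod.remove[of E k] is_ideal_mult_right)

lemma esym2_minus_vars:
  assumes "i \<noteq> j"
  shows "esym2 - var i * var j \<in> face_prime {i, j}"
proof -
  have "card {i, j} = 2" using assms by simp
  then have "esym2 - var i * var j = (\<Sum>E\<in>{E. card E = 2} - {{i, j}}. \<Prod>k\<in>E. var k)"
    using assms by (simp add: esym2_def sum.remove[of "{E. card E = 2}" "{i, j}"])
  also have "\<dots> \<in> face_prime {i, j}"
  proof (rule is_ideal_sum[OF is_ideal_face_prime])
    fix E assume E: "E \<in> {E. card E = 2} - {{i, j}}"
    have "\<not> E \<subseteq> {i, j}"
      using E card_seteq[of "{i, j}" E] assms by auto
    then obtain k where k: "k \<in> E" "k \<notin> {i, j}" by blast
    then show "(\<Prod>k\<in>E. var k) \<in> face_prime {i, j}"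
      by (intro prod_var_in_ideal[OF is_ideal_face_prime]) (auto simp: var_mem_sr_ideal)
  qed
  finally show ?thesis .
qed

lemma var_mult_var: "var i * var j = single (single i 1 + single j 1) 1"
  by (simp add: var_def mult_single)

lemma is_ideal_max: "is_ideal (sr_ideal {{}} :: ('v, 'k::field) mpoly set)"
  by (rule is_ideal_sr_ideal) (auto simp: downset_def)

lemma esym1_in_max: "esym1 \<in> sr_ideal {{}}"
  unfolding esym1_def
  by (rule is_ideal_sum[OF is_ideal_max]) (auto simp: var_mem_sr_ideal)

lemma esym2_in_max: "esym2 \<in> sr_ideal {{}}"
  unfolding esym2_def
proof (rule is_ideal_sum[OF is_ideal_max])
  fix E :: "'a set" assume "E \<in> {E. card E = 2}"
  then obtain i where i: "i \<in> E" by (auto simp: card_2_iff)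
  then show "(\<Prod>k\<in>E. var k) \<in> (sr_ideal {{}} :: ('a, 'b) mpoly set)"
    by (intro prod_var_in_ideal[OF is_ideal_max]) (auto simp: var_mem_sr_ideal)
qed

lemma esym2_not_in_face_prime:
  assumes "i \<noteq> j"
  shows "(esym2 :: ('v::finite, 'k::field) mpoly) \<notin> face_prime {i, j}"
proof
  assume e: "(esym2 :: ('v, 'k) mpoly) \<in> face_prime {i, j}"
  then have "esym2 - (esym2 - var i * var j) \<in> (face_prime {i, j} :: ('v, 'k) mpoly set)"
    using esym2_minus_vars[OF assms] by (rule is_ideal_diff[OF is_ideal_face_prime])
  then show False by (simp add: var_mult_var sr_ideal_def keys_mono_add)
qed

lemma esym2_in_face_prime_singleton: "(esym2 :: ('v::finite, 'k::field) mpoly) \<in> face_prime {i}"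
  unfolding esym2_def
proof (rule is_ideal_sum[OF is_ideal_face_prime])
  fix E :: "'v set" assume E: "E \<in> {E. card E = 2}"
  have "\<not> E \<subseteq> {i}" using E card_mono[of "{i}" E] by auto
  then obtain k where k: "k \<in> E" "k \<noteq> i" by blast
  then show "(\<Prod>k\<in>E. var k) \<in> (face_prime {i} :: ('v, 'k) mpoly set)"
    by (intro prod_var_in_ideal[OF is_ideal_face_prime]) (auto simp: var_mem_sr_ideal)
qed

section \<open>Regular pairs on graphs\<close>

text \<open>
  The element \<open>g\<close> is a nonzerodivisor modulo \<open>A + (f)\<close>.
\<close>
definition regular_second :: "'r::comm_ring_1 \<Rightarrow> 'r \<Rightarrow> 'r set \<Rightarrow> bool" where
  "regular_second f g A \<longleftrightarrow> (\<forall>p q. g * p - f * q \<in> A \<longrightarrow> (\<exists>w. p - f * w \<in> A))"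

text \<open>
  This follows the exact sequence \<open>0 \<rightarrow> R/(A \<inter> B) \<rightarrow> R/A \<oplus> R/B \<rightarrow> R/(A + B) \<rightarrow> 0\<close>: the quotients of
  \<open>p\<close> by \<open>f\<close> found modulo \<open>A\<close> and modulo \<open>B\<close> differ by an element that \<open>f\<close> multiplies into
  \<open>A + B\<close>. If \<open>f\<close> is a nonzerodivisor there, the two quotients can be corrected to a common one.
\<close>
lemma regular_second_Int:
  assumes A: "is_ideal A" and B: "is_ideal B"
    and "regular_second f g A" "regular_second f g B"
    and reg: "\<And>a b x. a \<in> A \<Longrightarrow> b \<in> B \<Longrightarrow> f * x = a + b \<Longrightarrow> \<exists>a\<in>A. \<exists>b\<in>B. x = a + b"
  shows "regular_second f g (A \<inter> B)"
  unfolding regular_second_def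
proof (intro allI impI)
  fix p q assume *: "g * p - f * q \<in> A \<inter> B"
  then obtain s t where s: "p - f * s \<in> A" and t: "p - f * t \<in> B"
    using assms(3,4) unfolding regular_second_def by blast
  have "f * (s - t) = - (p - f * s) + (p - f * t)" by (simp add: algebra_simps)
  then obtain a b where ab: "a \<in> A" "b \<in> B" "s - t = a + b"
    using reg[OF is_ideal_uminus[OF A s] t] by blast
  define w where "w = s - a"
  have w: "w = t + b" using ab(3) by (simp add: w_def algebra_simps)
  have "p - f * w = (p - f * s) + f * a" by (simp add: w_def algebra_simps)
  then have "p - f * w \<in> A" using is_ideal_add[OF A s is_ideal_mult[OF A ab(1), of f]] by (simp only:)
  moreover have "p - f * w = (p - f * t) - f * b" by (simp add: w algebra_simps)
  then have "p - f * w \<in> B" using is_ideal_diff[OF B t is_ideal_mult[OF B ab(2), of f]] by (simp only:)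
  ultimately show "\<exists>w. p - f * w \<in> A \<inter> B" by blast
qed

text \<open>
  It is easier to take the two parameters in the opposite order, because \<open>x\<^sub>i x\<^sub>j\<close> is a monomial: if
  \<open>x\<^sub>i x\<^sub>j p\<close> equals \<open>(x\<^sub>i + x\<^sub>j) q\<close> modulo the prime of the edge, then \<open>q\<close> vanishes on both end points
  and is thus divisible by \<open>x\<^sub>i x\<^sub>j\<close>, which can then be cancelled.
\<close>
lemma regular_second_edge:
  fixes i j :: "'v::{finite,linorder}"
  assumes ij: "i \<noteq> j"
  shows "regular_second esym1 esym2 (face_prime {i, j} :: ('v, 'k::field) mpoly set)"
  unfolding regular_second_def
proof (intro allI impI)
  let ?P = "face_prime {i, j} :: ('v, 'k) mpoly set"
  note P = is_ideal_face_prime[of "{i, j}", where 'k = 'k]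
  fix p q :: "('v, 'k) mpoly"
  assume *: "esym2 * p - esym1 * q \<in> ?P"
  have q: "q \<in> face_prime {k}" if "k \<in> {i, j}" for k
  proof -
    note Pk = is_ideal_face_prime[of "{k}", where 'k = 'k]
    have "?P \<subseteq> face_prime {k}" using that by (intro sr_ideal_antimono) auto
    with * have "esym2 * p - esym1 * q \<in> face_prime {k}" by blast
    with is_ideal_mult_right[OF Pk esym2_in_face_prime_singleton]
    have "esym2 * p - (esym2 * p - esym1 * q) \<in> face_prime {k}"
      by (rule is_ideal_diff[OF Pk])
    then have "esym1 * q \<in> face_prime {k}" by simp
    then show ?thesis
      using is_prime_mult_mem[OF is_prime_face_prime] esym1_not_in_face_prime by blast
  qed
  have "q \<in> adjoin ?P UNIV (var i * var j)"
  proof (rule mem_ideal_by_terms)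
    show "is_ideal (adjoin ?P UNIV (var i * var j))"
      by (rule is_ideal_adjoin[OF P is_ideal_UNIV])
    fix u assume u: "u \<in> keys q"
    show "single u (lookup q u) \<in> adjoin ?P UNIV (var i * var j)"
    proof (cases "keys u \<subseteq> {i, j}")
      case False
      then have "single u (lookup q u) \<in> ?P" by (auto simp: sr_ideal_def)
      then show ?thesis using subset_adjoin[OF is_ideal_UNIV] by blast
    next
      case True
      have nk: "\<not> keys u \<subseteq> {k}" if "k \<in> {i, j}" for k
        using q[OF that] u unfolding sr_ideal_def by blast
      have "i \<in> keys u" "j \<in> keys u"
        using True nk[of i] nk[of j] by blast+
      then have "u = single i 1 + single j 1 + (u - (single i 1 + single j 1))"
        using ij by (intro poly_mapping_eqI)
          (auto simp: lookup_add lookup_minus lookup_single when_def in_keys_iff)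
      then have "single u (lookup q u) =
          var i * var j * single (u - (single i 1 + single j 1)) (lookup q u)"
        by (simp add: var_mult_var mult_single)
      then show ?thesis using mult_in_adjoin[OF P UNIV_I] by metis
    qed
  qed
  then obtain a t where a: "a \<in> ?P" "q = a + var i * var j * t" unfolding adjoin_def by blast
  have "esym2 * (p - esym1 * t) = (esym2 * p - esym1 * q) + esym1 * a - esym1 * t * (esym2 - var i * var j)"
    by (simp add: a(2) algebra_simps)
  then have "esym2 * (p - esym1 * t) \<in> ?P"
    using is_ideal_diff[OF P is_ideal_add[OF P * is_ideal_mult[OF P a(1)]]
      is_ideal_mult[OF P esym2_minus_vars[OF ij]]] by metis
  then show "\<exists>w. p - esym1 * w \<in> ?P"
    using is_prime_mult_mem[OF is_prime_face_prime esym2_not_in_face_prime[OF ij]] by blast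
qed

text \<open>
  The new edge meets the old complex in one or both of its end points, and \<open>esym1\<close> is a
  nonzerodivisor on the coordinate ring of such a nonempty set of points.
\<close>
lemma regular_second_attach_edge:
  fixes i j :: "'v::{finite,linorder}"
  assumes \<Delta>: "downset \<Delta>" "{i} \<in> \<Delta>" and ij: "i \<noteq> j"
    and reg: "regular_second esym1 esym2 (sr_ideal \<Delta> :: ('v, 'k::field) mpoly set)"
  shows "regular_second esym1 esym2 (sr_ideal (\<Delta> \<union> Pow {i, j}) :: ('v, 'k) mpoly set)"
proof (cases "{i, j} \<in> \<Delta>")
  case True
  then have "\<Delta> \<union> Pow {i, j} = \<Delta>" using \<Delta>(1) unfolding downset_def by blast
  then show ?thesis using reg by simp
next
  case False
  let ?\<Theta> = "\<Delta> \<inter> Pow {i, j}"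
  have \<Theta>: "downset ?\<Theta>" using \<Delta>(1) by (intro downset_Int downset_Pow)
  have sub: "F \<subseteq> {i} \<or> F = {j}" if "F \<in> ?\<Theta>" for F
  proof -
    have "F \<subseteq> {i, j}" "F \<noteq> {i, j}" using that False by blast+
    then show ?thesis by blast
  qed
  show ?thesis
    unfolding sr_ideal_Un
  proof (rule regular_second_Int)
    fix a b x :: "('v, 'k) mpoly"
    assume ab: "a \<in> sr_ideal \<Delta>" "b \<in> face_prime {i, j}" and x: "esym1 * x = a + b"
    have s: "sr_ideal \<Delta> \<subseteq> (sr_ideal ?\<Theta> :: ('v, 'k) mpoly set)"
      "face_prime {i, j} \<subseteq> (sr_ideal ?\<Theta> :: ('v, 'k) mpoly set)"
      by (intro sr_ideal_antimono; blast)+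
    have *: "esym1 * x \<in> sr_ideal ?\<Theta>"
      unfolding x by (rule is_ideal_add[OF is_ideal_sr_ideal[OF \<Theta>]]) (use ab s in blast)+
    have "x \<in> face_prime F" if F: "F \<in> ?\<Theta>" for F
    proof -
      obtain v where v: "F \<subseteq> {v}" "{v} \<in> ?\<Theta>" using sub[OF F] F \<Delta>(2) by blast
      have "esym1 * x \<in> face_prime {v}"
        using * v(2) mem_sr_ideal_iff_faces[OF \<Theta>] by blast
      then have "x \<in> face_prime {v}"
        using is_prime_mult_mem[OF is_prime_face_prime] esym1_not_in_face_prime by blast
      moreover have "Pow F \<subseteq> Pow {v}" using v(1) by blast
      ultimately show ?thesis using sr_ideal_antimono by blast
    qed
    then have "x \<in> sr_ideal ?\<Theta>" using mem_sr_ideal_iff_faces[OF \<Theta>] by blast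
    then show "\<exists>a\<in>sr_ideal \<Delta>. \<exists>b\<in>face_prime {i, j}. x = a + b"
      by (rule sr_ideal_Int_split)
  qed (rule is_ideal_sr_ideal[OF \<Delta>(1)] is_ideal_face_prime reg regular_second_edge[OF ij])+
qed

text \<open>
  The complete graph is built from a star by attaching edges, each of which has an end point in
  the graph built so far.
\<close>
lemma regular_second_complete_graph:
  assumes "2 \<le> card (UNIV :: 'v::{finite,linorder} set)"
  shows "regular_second esym1 esym2 (sr_ideal {F. card F < 3} :: ('v, 'k::field) mpoly set)"
proof -
  let ?reg = "\<lambda>\<Delta>. regular_second esym1 esym2 (sr_ideal \<Delta> :: ('v, 'k) mpoly set)"
  obtain i :: 'v where True by blast
  define star where "star = (\<lambda>T. \<Union>j\<in>T. Pow {i, j})"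
  have down: "downset (star T)" for T unfolding star_def by (intro downset_UN downset_Pow)
  have star: "?reg (star T)" if "finite T" "T \<noteq> {}" "i \<notin> T" for T
    using that
  proof (induction T rule: finite_ne_induct)
    case (singleton j)
    then show ?case by (simp add: star_def regular_second_edge del: Pow_insert)
  next
    case (insert j T)
    have "{i} \<in> star T" using insert.hyps by (auto simp: star_def)
    then have "?reg (star T \<union> Pow {i, j})"
      using insert by (intro regular_second_attach_edge down) auto
    moreover have "star (insert j T) = star T \<union> Pow {i, j}" unfolding star_def by blast
    ultimately show ?case by simp
  qed
  define S where "S = UNIV - {i}"
  have S: "S \<noteq> {}"
  proof
    assume "S = {}"
    then have "(UNIV :: 'v set) = {i}" unfolding S_def by blast
    then have "card (UNIV :: 'v set) = card {i}" by (rule arg_cong)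
    then show False using assms by simp
  qed
  have sing: "{k} \<in> star S" for k
    using S unfolding star_def S_def by blast
  have all: "?reg (star S \<union> (\<Union>E\<in>\<E>. Pow E))" if "finite \<E>" "\<E> \<subseteq> {E. card E = 2}" for \<E>
    using that
  proof (induction \<E> rule: finite_induct)
    case empty
    then show ?case using star[of S] S by (simp add: S_def)
  next
    case (insert E \<E>)
    let ?D = "star S \<union> (\<Union>E\<in>\<E>. Pow E)"
    obtain k l where E: "E = {k, l}" "k \<noteq> l" using insert.prems by (auto simp: card_2_iff)
    have "?reg (?D \<union> Pow {k, l})"
    proof (rule regular_second_attach_edge)
      show "downset ?D" by (intro downset_Un downset_UN down downset_Pow)
      show "{k} \<in> ?D" using sing by blast
      show "?reg ?D" using insert by blast
    qed (rule E(2))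
    moreover have "?D \<union> Pow {k, l} = star S \<union> (\<Union>E\<in>insert E \<E>. Pow E)" unfolding E(1) by blast
    ultimately show ?case by simp
  qed
  have "star S \<union> (\<Union>E\<in>{E. card E = 2}. Pow E) = {F. card F < 3}"
  proof (intro equalityI subsetI)
    fix F assume "F \<in> star S \<union> (\<Union>E\<in>{E. card E = 2}. Pow E)"
    moreover have "card {i, j} = 2" if "j \<in> S" for j using that by (simp add: S_def card_insert_if)
    ultimately obtain E where "F \<subseteq> E" "card E = 2" unfolding star_def by blast
    then show "F \<in> {F. card F < 3}" using card_mono[of E F] by simp
  next
    fix F :: "'v set" assume "F \<in> {F. card F < 3}"
    then obtain E where "F \<subseteq> E" "card E = 2"
      using exists_subset_between[of F 2 UNIV] assms by auto
    then show "F \<in> star S \<union> (\<Union>E\<in>{E. card E = 2}. Pow E)" by blast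
  qed
  then show ?thesis using all[of "{E. card E = 2}"] by simp
qed


section \<open>Cohen-Macaulay subquotients\<close>

lemma sr_ideal_no_constant: "x \<in> sr_ideal \<Delta> \<Longrightarrow> {} \<in> \<Delta> \<Longrightarrow> 0 \<notin> keys x"
  unfolding sr_ideal_def by (metis (mono_tags, lifting) keys_zero mem_Collect_eq)

lemma mem_adjoin_UNIV: "x \<in> adjoin A UNIV f \<longleftrightarrow> (\<exists>w. x - f * w \<in> A)"
proof
  assume "\<exists>w. x - f * w \<in> A"
  then obtain w where "x - f * w \<in> A" by blast
  moreover have "x = (x - f * w) + f * w" by simp
  ultimately show "x \<in> adjoin A UNIV f" unfolding adjoin_def by blast
next
  assume "x \<in> adjoin A UNIV f"
  then obtain a w where "a \<in> A" "x = a + f * w" unfolding adjoin_def by blast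
  then have "x - f * w \<in> A" by simp
  then show "\<exists>w. x - f * w \<in> A" ..
qed

lemma reg_seq_pair:
  assumes "\<And>x. f * x \<in> A \<Longrightarrow> x \<in> A" "regular_second f g A"
    and "adjoin (adjoin A UNIV f) UNIV g \<noteq> UNIV"
  shows "reg_seq A UNIV [f, g]"
proof -
  have "x \<in> adjoin A UNIV f" if "g * x \<in> adjoin A UNIV f" for x
    using that assms(2) unfolding mem_adjoin_UNIV regular_second_def by blast
  with assms show ?thesis by simp
qed

lemma adjoin_UNIV_no_constant:
  fixes A :: "('v::finite, 'k::field) mpoly set"
  assumes "f \<in> sr_ideal {{}}" "\<And>a. a \<in> A \<Longrightarrow> 0 \<notin> keys a" "x \<in> adjoin A UNIV f"
  shows "0 \<notin> keys x"
  by (rule adjoin_avoids_lowest_degree[OF _ assms]) (auto simp: mono_deg_def)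

lemma no_constant_imp_proper:
  fixes A :: "('v, 'k::field) mpoly set"
  assumes "\<And>a. a \<in> A \<Longrightarrow> 0 \<notin> keys a"
  shows "A \<noteq> UNIV"
  using assms[of 1] by auto

lemma cohen_macaulay_dim2:
  fixes A :: "('v::{finite,linorder}, 'k::field) mpoly set"
  assumes A: "A = {b \<in> UNIV. \<forall>V\<in>\<V>. b \<in> face_prime V}" and card: "\<And>V. V \<in> \<V> \<Longrightarrow> card V = 2"
    and ne: "\<V> \<noteq> {}" and reg: "regular_second esym1 esym2 A"
  shows "subq_dim A UNIV = 2" "subq_depth (sr_ideal {{}}) A UNIV = 2"
proof -
  obtain V where V: "V \<in> \<V>" using ne by blast
  have noc: "0 \<notin> keys a" if "a \<in> A" for a
    using that V sr_ideal_no_constant[of a "Pow V"] by (auto simp: A)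
  have ub: "subq_dim A UNIV \<le> enat 2" "subq_depth (sr_ideal {{}}) A UNIV \<le> enat 2"
    by (rule pure_subquotient[OF is_ideal_UNIV A]; simp add: card)+
  have "A \<subseteq> face_prime V" using V by (auto simp: A)
  moreover have "(1 :: ('v, 'k) mpoly) \<notin> face_prime V" by (simp add: sr_ideal_def)
  ultimately have "enat 2 \<le> subq_dim A UNIV"
    using subq_dim_ge_face[of A V 1 UNIV] card[OF V] by simp
  with ub show "subq_dim A UNIV = 2" by (simp add: numeral_eq_enat)
  have "reg_seq A UNIV [esym1, esym2]"
  proof (rule reg_seq_pair[OF _ reg])
    show "x \<in> A" if "esym1 * x \<in> A" for x
    proof (rule nonzerodivisor_pure[OF A _ UNIV_I that])
      fix V assume "V \<in> \<V>"
      then have "V \<noteq> {}" using card by fastforce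
      then show "(esym1 :: ('v, 'k) mpoly) \<notin> face_prime V" by (rule esym1_not_in_face_prime)
    qed
    show "adjoin (adjoin A UNIV esym1) UNIV esym2 \<noteq> UNIV"
      by (rule no_constant_imp_proper)
        (rule adjoin_UNIV_no_constant[OF esym2_in_max adjoin_UNIV_no_constant[OF esym1_in_max noc]])
  qed
  then have "enat 2 \<le> subq_depth (sr_ideal {{}}) A UNIV"
    using subq_depth_ge[of A UNIV "[esym1, esym2]" "sr_ideal {{}}"]
    by (simp add: numeral_2_eq_2 esym1_in_max esym2_in_max)
  with ub show "subq_depth (sr_ideal {{}}) A UNIV = 2" by (simp add: numeral_eq_enat)
qed

lemma cohen_macaulay_dim1:
  fixes A :: "('v::{finite,linorder}, 'k::field) mpoly set"
  assumes B: "is_ideal B" and A: "A = {b \<in> B. \<forall>V\<in>\<V>. b \<in> face_prime V}"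
    and card: "\<And>V. V \<in> \<V> \<Longrightarrow> card V = 1" and V: "V \<in> \<V>"
    and b: "b \<in> B" "b \<notin> face_prime V"
    and u: "u \<in> keys b" "\<And>a. a \<in> A \<Longrightarrow> u \<notin> keys a"
    and low: "\<And>b w. b \<in> B \<Longrightarrow> w \<in> keys b \<Longrightarrow> mono_deg u \<le> mono_deg w"
  shows "subq_dim A B = 1" "subq_depth (sr_ideal {{}}) A B = 1"
proof -
  have ub: "subq_dim A B \<le> enat 1" "subq_depth (sr_ideal {{}}) A B \<le> enat 1"
    by (rule pure_subquotient[OF B A]; simp add: card)+
  have "A \<subseteq> face_prime V" using V by (auto simp: A)
  then have "enat 1 \<le> subq_dim A B"
    using subq_dim_ge_face[of A V b B] card[OF V] b by simp
  with ub show "subq_dim A B = 1" by (simp add: one_enat_def)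
  have "adjoin A B esym1 \<noteq> B"
  proof
    assume "adjoin A B esym1 = B"
    then have *: "b \<in> adjoin A B esym1" using b(1) by simp
    have "u \<notin> keys b" by (rule adjoin_avoids_lowest_degree[OF low esym1_in_max u(2) *])
    then show False using u(1) by simp
  qed
  moreover have "x \<in> A" if "x \<in> B" "esym1 * x \<in> A" for x
  proof (rule nonzerodivisor_pure[OF A _ that])
    fix V assume "V \<in> \<V>"
    then have "V \<noteq> {}" using card by fastforce
    then show "(esym1 :: ('v, 'k) mpoly) \<notin> face_prime V" by (rule esym1_not_in_face_prime)
  qed
  ultimately have "reg_seq A B [esym1]" by simp
  then have "enat 1 \<le> subq_depth (sr_ideal {{}}) A B"
    using subq_depth_ge[of A B "[esym1]" "sr_ideal {{}}"]
    by (simp add: esym1_in_max)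
  with ub show "subq_depth (sr_ideal {{}}) A B = 1" by (simp add: one_enat_def)
qed

lemma sr_ideal_card_less:
  assumes "n \<le> card (UNIV :: 'v::finite set)"
  shows "(sr_ideal {F :: 'v set. card F < Suc n} :: ('v, 'k::field) mpoly set) =
    {b \<in> UNIV. \<forall>V\<in>{V. card V = n}. b \<in> face_prime V}"
proof -
  have "\<exists>E. F \<subseteq> E \<and> card E = n" if "card F < Suc n" for F :: "'v set"
    using exists_subset_between[of F n UNIV] that assms by auto
  moreover have "card F < Suc n" if "F \<subseteq> E" "card E = n" for F E :: "'v set"
    using card_mono[of E F] that by simp
  ultimately have "{F :: 'v set. card F < Suc n} = (\<Union>V\<in>{V. card V = n}. Pow V)" by blast
  then show ?thesis by (auto simp: sr_ideal_def)
qed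

text \<open>
  The complex of all sets of at most \<open>n\<close> elements is pure, and for \<open>n \<le> 2\<close> the first \<open>n\<close>
  elementary symmetric polynomials form a regular sequence on its coordinate ring.
\<close>
lemma cohen_macaulay_skeleton:
  assumes "n \<le> 2" "n \<le> card (UNIV :: 'v::{finite,linorder} set)"
  defines "A \<equiv> sr_ideal {F :: 'v set. card F < Suc n} :: ('v, 'k::field) mpoly set"
  shows "subq_depth (sr_ideal {{}}) A UNIV = subq_dim A UNIV"
proof -
  have A: "A = {b \<in> UNIV. \<forall>V\<in>{V. card V = n}. b \<in> face_prime V}"
    unfolding A_def by (rule sr_ideal_card_less[OF assms(2)])
  obtain V :: "'v set" where V: "card V = n"
    using exists_subset_between[of "{} :: 'v set" n UNIV] assms(2) by auto
  have noc: "0 \<notin> keys a" if "a \<in> A" for a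
    using that sr_ideal_no_constant[of a "{F. card F < Suc n}"] by (auto simp: A_def)
  consider "n = 0" | "n = 1" | "n = 2" using assms(1) by linarith
  then show ?thesis
  proof cases
    case 1
    have "subq_dim A UNIV \<le> enat 0" "subq_depth (sr_ideal {{}}) A UNIV \<le> enat 0"
      by (rule pure_subquotient[OF is_ideal_UNIV A]; simp add: 1)+
    then show ?thesis by (simp flip: zero_enat_def)
  next
    case 2
    have "subq_dim A UNIV = 1" "subq_depth (sr_ideal {{}}) A UNIV = 1"
      by (rule cohen_macaulay_dim1[OF is_ideal_UNIV A, where V = V and b = 1 and u = 0];
        use V 2 noc in \<open>simp add: sr_ideal_def mono_deg_def\<close>)+
    then show ?thesis by simp
  next
    case 3
    have reg: "regular_second esym1 esym2 A"
      using regular_second_complete_graph[where 'v = 'v and 'k = 'k] assms(2)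
      unfolding A_def 3 by simp
    have ne: "{V :: 'v set. card V = n} \<noteq> {}" using V by blast
    show ?thesis
      using cohen_macaulay_dim2[OF A _ ne reg] 3 by simp
  qed
qed

text \<open>
  The two steps \<open>A \<subset> B \<subset> R\<close> of the dimension filtration of the complex that consists of an edge
  and some isolated points: \<open>R/B\<close> is the coordinate ring of the edge, and \<open>B/A\<close> collects the
  functions on the points that vanish on the edge.
\<close>
lemma cohen_macaulay_edge_and_points:
  fixes i j k :: "'v::{finite,linorder}"
  assumes "i \<noteq> j" "k \<notin> {i, j}"
  defines "A \<equiv> sr_ideal ({F. card F < 2} \<union> Pow {i, j}) :: ('v, 'k::field) mpoly set"
    and "B \<equiv> face_prime {i, j} :: ('v, 'k) mpoly set"
  shows "subq_dim A B = 1" "subq_depth (sr_ideal {{}}) A B = 1"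
    and "subq_dim B UNIV = 2" "subq_depth (sr_ideal {{}}) B UNIV = 2"
    and "A \<subset> B" "B \<subset> UNIV"
proof -
  have B: "is_ideal B" unfolding B_def by (rule is_ideal_face_prime)
  have "F \<in> {F. card F < 2} \<union> Pow {i, j} \<longleftrightarrow> F \<in> Pow {i, j} \<or> (\<exists>l\<in>-{i, j}. F \<subseteq> {l})" for F
  proof -
    have "F \<subseteq> {i, j} \<or> (\<exists>l\<in>-{i, j}. F \<subseteq> {l})" if "card F < 2"
    proof -
      have "F = {} \<or> (\<exists>l. F = {l})" using that
        by (metis One_nat_def card_1_singleton_iff card_0_eq finite less_2_cases)
      then show ?thesis by blast
    qed
    moreover have "card F < 2" if "F \<subseteq> {l}" for l using card_mono[of "{l}" F] that by simp
    ultimately show ?thesis by blast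
  qed
  then have A: "A = {b \<in> B. \<forall>V\<in>(\<lambda>l. {l}) ` (-{i, j}). b \<in> face_prime V}"
    unfolding A_def B_def sr_ideal_def by blast
  let ?u = "single k 1 :: 'v mono"
  have noA: "?u \<notin> keys a" if "a \<in> A" for a
    using that by (auto simp: A_def sr_ideal_def)
  have k: "var k \<in> B" using assms(2) by (simp add: B_def var_mem_sr_ideal)
  have not_k: "(var k :: ('v, 'k) mpoly) \<notin> face_prime {k}" by (simp add: var_mem_sr_ideal)
  have key_k: "?u \<in> keys (var k :: ('v, 'k) mpoly)" by (simp add: var_def)
  have deg: "mono_deg ?u = 1"
    by (simp add: mono_deg_def lookup_single when_def)
  have low: "mono_deg ?u \<le> mono_deg w" if "b \<in> B" "w \<in> keys b" for b w
  proof -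
    have "keys w \<noteq> {}" using that unfolding B_def sr_ideal_def by blast
    then show ?thesis unfolding deg by (rule mono_deg_pos)
  qed
  show "subq_dim A B = 1" "subq_depth (sr_ideal {{}}) A B = 1"
    by (rule cohen_macaulay_dim1[OF B A _ _ k not_k key_k noA low]; use assms(2) in auto)+
  have "B = {b \<in> UNIV. \<forall>V\<in>{{i, j}}. b \<in> face_prime V}" by (simp add: B_def)
  moreover have "regular_second esym1 esym2 B"
    unfolding B_def by (rule regular_second_edge[OF assms(1)])
  ultimately show "subq_dim B UNIV = 2" "subq_depth (sr_ideal {{}}) B UNIV = 2"
    using cohen_macaulay_dim2[of B "{{i, j}}"] assms(1) by auto
  have "var k \<notin> A" by (simp add: A_def var_mem_sr_ideal)
  then show "A \<subset> B" using A k by blast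
  have "(1 :: ('v, 'k) mpoly) \<notin> B" by (simp add: B_def sr_ideal_def)
  then show "B \<subset> UNIV" by blast
qed

section \<open>Two disjoint faces\<close>

text \<open>
  Let \<open>P\<close> and \<open>P'\<close> be the two face primes. Their sum is the maximal ideal and their intersection is
  \<open>J\<close>. Split a regular element as \<open>f = f\<^sub>1 + f\<^sub>2\<close> along this sum. Then \<open>f\<^sub>1\<close> is not in \<open>J + (f)\<close>, but
  the whole maximal ideal multiplies \<open>f\<^sub>1\<close> into \<open>J + (f)\<close>, so no regular sequence continues
  after \<open>f\<close>.
\<close>
lemma depth_two_disjoint_faces:
  fixes V W :: "'v::{finite,linorder} set"
  assumes disj: "V \<inter> W = {}" and ne: "V \<noteq> {}" "W \<noteq> {}"
  defines "J \<equiv> sr_ideal (Pow V \<union> Pow W) :: ('v, 'k::field) mpoly set"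
  shows "subq_depth (sr_ideal {{}}) J UNIV \<le> 1"
  unfolding subq_depth_def
proof (rule Sup_least, clarify)
  fix fs :: "('v, 'k) mpoly list"
  assume fs: "reg_seq J UNIV fs" "set fs \<subseteq> sr_ideal {{}}"
  show "enat (length fs) \<le> 1"
  proof (rule ccontr)
    assume "\<not> enat (length fs) \<le> 1"
    then have "2 \<le> length fs" by (simp add: one_enat_def)
    then obtain f g gs where fs_eq: "fs = f # g # gs"
      by (metis One_nat_def Suc_1 Suc_le_length_iff)
    note PV = is_ideal_face_prime[of V, where 'k = 'k] and PW = is_ideal_face_prime[of W, where 'k = 'k]
    have J: "J = face_prime V \<inter> face_prime W" unfolding J_def by (rule sr_ideal_Un)
    have max: "sr_ideal {{}} = (sr_ideal (Pow V \<inter> Pow W) :: ('v, 'k) mpoly set)"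
      using disj by (simp flip: Pow_Int_eq)
    from fs(1) have f_reg: "\<And>x. f * x \<in> J \<Longrightarrow> x \<in> J"
      and g_reg: "\<And>x. g * x \<in> adjoin J UNIV f \<Longrightarrow> x \<in> adjoin J UNIV f"
      by (simp_all add: fs_eq)
    obtain f1 f2 where f: "f1 \<in> face_prime V" "f2 \<in> face_prime W" "f = f1 + f2"
      using fs(2) sr_ideal_Int_split[of f "Pow V" "Pow W"] unfolding max fs_eq by auto
    obtain g1 g2 where g: "g1 \<in> face_prime V" "g2 \<in> face_prime W" "g = g1 + g2"
      using fs(2) sr_ideal_Int_split[of g "Pow V" "Pow W"] unfolding max fs_eq by auto
    obtain v w where vw: "v \<in> V" "w \<in> W" using ne by blast
    have "(var v :: ('v, 'k) mpoly) \<in> face_prime W" "(var v :: ('v, 'k) mpoly) \<notin> face_prime V"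
      "(var w :: ('v, 'k) mpoly) \<in> face_prime V" "(var w :: ('v, 'k) mpoly) \<notin> face_prime W"
      using vw disj by (auto simp: var_mem_sr_ideal)
    then have fV: "f \<notin> face_prime V" and fW: "f \<notin> face_prime W"
      using f_reg[of "var v"] f_reg[of "var w"] is_ideal_mult[OF PV] is_ideal_mult[OF PW]
        is_ideal_mult_right[OF PV] is_ideal_mult_right[OF PW] unfolding J by blast+
    \<comment> \<open>The class of \<open>f\<^sub>1\<close> is annihilated by \<open>g\<close>, since both mixed products lie in \<open>J\<close>.\<close>
    have "g * f1 - f * g1 = f1 * g2 - f2 * g1" by (simp add: f g algebra_simps)
    also have "\<dots> \<in> J"
      unfolding J using f g
      by (simp add: is_ideal_diff[OF PV] is_ideal_diff[OF PW] is_ideal_mult[OF PV] is_ideal_mult[OF PW]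
        is_ideal_mult_right[OF PV] is_ideal_mult_right[OF PW])
    finally have "f1 \<in> adjoin J UNIV f" using g_reg mem_adjoin_UNIV by blast
    then obtain c where c: "f1 - f * c \<in> J" unfolding mem_adjoin_UNIV by blast
    \<comment> \<open>If \<open>f\<^sub>1\<close> were a multiple \<open>f c\<close> modulo \<open>J\<close>, then \<open>c\<close> would vanish on \<open>V\<close> and \<open>1 - c\<close> on \<open>W\<close>, which is impossible at the origin.\<close>
    have "f1 - (f1 - f * c) \<in> face_prime V"
      by (rule is_ideal_diff[OF PV f(1)]) (use c in \<open>simp add: J\<close>)
    then have "c \<in> face_prime V"
      using is_prime_mult_mem[OF is_prime_face_prime fV] by simp
    have "f2 + (f1 - f * c) \<in> face_prime W"
      by (rule is_ideal_add[OF PW f(2)]) (use c in \<open>simp add: J\<close>)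
    moreover have "f2 + (f1 - f * c) = f * (1 - c)" by (simp add: f(3) algebra_simps)
    ultimately have "1 - c \<in> face_prime W"
      using is_prime_mult_mem[OF is_prime_face_prime fW] by simp
    have "0 \<notin> keys c" "0 \<notin> keys (1 - c)"
      using \<open>c \<in> face_prime V\<close> \<open>1 - c \<in> face_prime W\<close> sr_ideal_no_constant by blast+
    then show False by (simp add: in_keys_iff lookup_minus)
  qed
qed


section \<open>Quotient modules and filtrations\<close>

context subquotient
begin

lemma subquotient_restrict:
  assumes "is_ideal C" "A \<subseteq> C" "C \<subseteq> B"
  shows "subquotient (Q\<lparr>carrier := \<phi> ` C\<rparr>) A C \<phi>"
  using assms ideal_A add_eq zero_eq smult_eq phi_eq_iff
  by unfold_locales (auto simp: subset_iff)

text \<open>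
  Quotients of subquotients are subquotients; the elements of the new copy are the cosets of the
  image of \<open>C\<close>.
\<close>
lemma subquotient_quot_module:
  assumes C: "is_ideal C" "A \<subseteq> C" "C \<subseteq> B"
  shows "subquotient (quot_module Q (\<phi> ` C)) C B (\<lambda>p. (\<lambda>c. \<phi> (c + p)) ` C)"
proof -
  let ?\<psi> = "\<lambda>p. (\<lambda>c. \<phi> (c + p)) ` C"
  have CB: "c \<in> B" if "c \<in> C" for c using that C by blast
  have coset: "\<phi> ` C +>\<^bsub>Q\<^esub> \<phi> p = ?\<psi> p" if "p \<in> B" for p
    using that CB by (auto simp: a_r_coset_def r_coset_def add_eq)
  have eq: "?\<psi> p = ?\<psi> q \<longleftrightarrow> p - q \<in> C" if pq: "p \<in> B" "q \<in> B" for p q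
  proof
    assume "?\<psi> p = ?\<psi> q"
    moreover have "\<phi> (0 + p) \<in> ?\<psi> p" using is_ideal_zero[OF C(1)] by blast
    ultimately obtain c where c: "c \<in> C" "\<phi> p = \<phi> (c + q)" by auto
    then have "p - (c + q) \<in> A"
      using phi_eq_iff[OF pq(1)] is_ideal_add[OF ideal_B CB pq(2)] by blast
    then have "(p - (c + q)) + c \<in> C" using C c by (intro is_ideal_add[OF C(1)]) auto
    then show "p - q \<in> C" by (simp add: algebra_simps)
  next
    have sub: "?\<psi> p \<subseteq> ?\<psi> q" if "p - q \<in> C" for p q
    proof
      fix y assume "y \<in> ?\<psi> p"
      then obtain c where c: "c \<in> C" "y = \<phi> (c + p)" by blast
      have "y = \<phi> ((c + (p - q)) + q)" using c by simp
      moreover have "c + (p - q) \<in> C" using c that by (intro is_ideal_add[OF C(1)])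
      ultimately show "y \<in> ?\<psi> q" by blast
    qed
    assume "p - q \<in> C"
    moreover from this have "q - p \<in> C" using is_ideal_uminus[OF C(1)] by fastforce
    ultimately show "?\<psi> p = ?\<psi> q" using sub by blast
  qed
  show ?thesis
  proof
    show "carrier (quot_module Q (\<phi> ` C)) = ?\<psi> ` B"
      using coset by (auto simp: quot_module_def A_RCOSETS_def' carrier_eq)
  next
    fix p q assume pq: "p \<in> B" "q \<in> B"
    have "?\<psi> p <+>\<^bsub>Q\<^esub> ?\<psi> q = (\<Union>c\<in>C. \<Union>c'\<in>C. {\<phi> (c + p) \<oplus>\<^bsub>Q\<^esub> \<phi> (c' + q)})"
      by (auto simp: set_add_def set_mult_def)
    also have "\<dots> = (\<Union>c\<in>C. \<Union>c'\<in>C. {\<phi> ((c + c') + (p + q))})"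
      using pq CB is_ideal_add[OF ideal_B] by (simp add: add_eq ac_simps)
    also have "\<dots> = ?\<psi> (p + q)"
    proof (intro equalityI subsetI)
      fix y assume "y \<in> ?\<psi> (p + q)"
      then obtain c where "c \<in> C" "y = \<phi> ((c + 0) + (p + q))" by auto
      then show "y \<in> (\<Union>c\<in>C. \<Union>c'\<in>C. {\<phi> ((c + c') + (p + q))})"
        using is_ideal_zero[OF C(1)] by blast
    qed (use is_ideal_add[OF C(1)] in blast)
    finally show "?\<psi> p \<oplus>\<^bsub>quot_module Q (\<phi> ` C)\<^esub> ?\<psi> q = ?\<psi> (p + q)"
      by (simp add: quot_module_def)
    show "?\<psi> p = ?\<psi> q \<longleftrightarrow> p - q \<in> C" by (rule eq[OF pq])
  next
    fix p r assume p: "p \<in> B"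
    have "\<phi> ` C +>\<^bsub>Q\<^esub> (r \<odot>\<^bsub>Q\<^esub> \<phi> (c + p)) = ?\<psi> (r * p)" if "c \<in> C" for c
    proof -
      have "c + p \<in> B" using that CB p by (intro is_ideal_add[OF ideal_B])
      then have "\<phi> ` C +>\<^bsub>Q\<^esub> (r \<odot>\<^bsub>Q\<^esub> \<phi> (c + p)) = ?\<psi> (r * (c + p))"
        using coset is_ideal_mult[OF ideal_B] by (simp add: smult_eq)
      also have "\<dots> = ?\<psi> (r * p)"
      proof (subst eq)
        show "r * (c + p) \<in> B" "r * p \<in> B" using \<open>c + p \<in> B\<close> p is_ideal_mult[OF ideal_B] by blast+
        show "r * (c + p) - r * p \<in> C" using is_ideal_mult[OF C(1) that, of r] by (simp add: algebra_simps)
      qed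
      finally show ?thesis .
    qed
    then have "(\<Union>x\<in>?\<psi> p. \<phi> ` C +>\<^bsub>Q\<^esub> (r \<odot>\<^bsub>Q\<^esub> x)) = (\<Union>c\<in>C. ?\<psi> (r * p))"
      by simp
    also have "\<dots> = ?\<psi> (r * p)" using is_ideal_zero[OF C(1)] by blast
    finally show "r \<odot>\<^bsub>quot_module Q (\<phi> ` C)\<^esub> ?\<psi> p = ?\<psi> (r * p)"
      by (simp add: quot_module_def)
  qed (use C ideal_B in \<open>auto simp: quot_module_def\<close>)
qed

end

lemma subquotient_ring_as_module:
  "subquotient (ring_as_module (ring_of_type_algebra :: 'r::comm_ring_1 ring)) {0} UNIV (\<lambda>p. p)"
  by unfold_locales (auto simp: ring_as_module_def is_ideal_def)

lemma subquotient_quotient_ring: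
  fixes J :: "'r::comm_ring_1 set"
  assumes "is_ideal J"
  shows "subquotient (quot_module (ring_as_module (ring_of_type_algebra :: 'r ring)) J) J UNIV
    (\<lambda>p. (\<lambda>c. c + p) ` J)"
  using subquotient.subquotient_quot_module[OF subquotient_ring_as_module assms]
    is_ideal_zero[OF assms] by simp

lemma subquotient_filtration_step:
  assumes "subquotient Q J UNIV \<phi>" "is_ideal A" "is_ideal B" "J \<subseteq> A" "A \<subseteq> B"
  defines "S \<equiv> quot_module (Q\<lparr>carrier := \<phi> ` B\<rparr>) (\<phi> ` A)"
  shows "module_dim ring_of_type_algebra S = subq_dim A B"
    and "depth ring_of_type_algebra \<mm> S = subq_depth \<mm> A B"
proof -
  interpret q: subquotient Q J UNIV \<phi> by fact
  interpret r: subquotient "Q\<lparr>carrier := \<phi> ` B\<rparr>" J B \<phi>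
    by (rule q.subquotient_restrict) (use assms in auto)
  interpret s: subquotient S A B "\<lambda>p. (\<lambda>c. \<phi> (c + p)) ` A"
    unfolding S_def by (rule r.subquotient_quot_module) (use assms in auto)
  show "module_dim ring_of_type_algebra S = subq_dim A B" by (rule s.module_dim_eq)
  show "depth ring_of_type_algebra \<mm> S = subq_depth \<mm> A B" by (rule s.depth_eq)
qed

lemma a_r_coset_type_ring:
  "J +>\<^bsub>(ring_of_type_algebra :: 'r::comm_ring_1 ring)\<^esub> p = (\<lambda>c. c + p) ` J"
  by (auto simp: a_r_coset_def r_coset_def)

text \<open>
  A filtration with strictly increasing dimensions and Cohen-Macaulay quotients, written as a chain
  of ideals of the ring.
\<close>
definition cm_chain :: "('v, 'k::field) mpoly set \<Rightarrow> nat \<Rightarrow> (nat \<Rightarrow> ('v, 'k) mpoly set) \<Rightarrow> bool" where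
  "cm_chain J r A \<longleftrightarrow> A 0 = J \<and> A r = UNIV \<and> (\<forall>i\<le>r. is_ideal (A i)) \<and>
    (\<forall>i<r. A i \<subset> A (Suc i)) \<and>
    (\<forall>i<r. subq_depth (sr_ideal {{}}) (A i) (A (Suc i)) = subq_dim (A i) (A (Suc i))) \<and>
    (\<forall>i. Suc i < r \<longrightarrow> subq_dim (A i) (A (Suc i)) < subq_dim (A (Suc i)) (A (Suc (Suc i))))"

lemma cm_chain_above:
  assumes "cm_chain J r A" "i \<le> r"
  shows "J \<subseteq> A i"
  using assms(2)
proof (induction i)
  case (Suc i)
  then have "A i \<subset> A (Suc i)" using assms(1) by (auto simp: cm_chain_def)
  with Suc show ?case by auto
qed (use assms(1) in \<open>auto simp: cm_chain_def\<close>)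

lemma SCM_imp_cm_chain:
  fixes J :: "('v::finite, 'k::field) mpoly set"
  assumes J: "is_ideal J" and "SCM J"
  shows "\<exists>r A. cm_chain J r A"
proof -
  let ?R = "mpoly_ring :: ('v, 'k) mpoly ring"
  let ?M = "quot_module (ring_as_module ?R) J"
  let ?\<phi> = "\<lambda>p. (\<lambda>c. c + p) ` J"
  interpret q: subquotient ?M J UNIV ?\<phi> by (rule subquotient_quotient_ring[OF J])
  let ?gr = "\<lambda>d. (\<lambda>p. J +>\<^bsub>?R\<^esub> p) ` homogeneous_polys d"
  from assms(2)[unfolded SCM_def sequentially_cohen_macaulay_def] obtain r F where
    gsub: "\<forall>i\<le>r. graded_submodule ?R ?M ?gr (F i)"
    and F0: "F 0 = {\<zero>\<^bsub>?M\<^esub>}" and Fr: "F r = carrier ?M"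
    and inc: "\<forall>i<r. F i \<subset> F (Suc i)"
    and cm: "\<forall>i<r. cohen_macaulay ?R graded_maximal_ideal (quot_module (?M\<lparr>carrier := F (Suc i)\<rparr>) (F i))"
    and dims: "\<forall>i. Suc i < r \<longrightarrow> module_dim ?R (quot_module (?M\<lparr>carrier := F (Suc i)\<rparr>) (F i)) <
        module_dim ?R (quot_module (?M\<lparr>carrier := F (Suc (Suc i))\<rparr>) (F (Suc i)))"
    by (elim exE conjE) (rule that)
  have sub: "submodule (F i) ?R ?M" if "i \<le> r" for i
    using gsub that by (simp add: graded_submodule_def)
  note inc = inc[rule_format] and cm = cm[rule_format] and dims = dims[rule_format]
  define A where "A = (\<lambda>i. {p \<in> UNIV. ?\<phi> p \<in> F i})"
  have A: "is_ideal (A i)" "J \<subseteq> A i" "F i = ?\<phi> ` A i" if "i \<le> r" for i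
    using q.submodule_preimage[OF sub[OF that]] unfolding A_def by auto
  have step: "module_dim ?R (quot_module (?M\<lparr>carrier := F (Suc i)\<rparr>) (F i)) = subq_dim (A i) (A (Suc i))"
    "depth ?R \<mm> (quot_module (?M\<lparr>carrier := F (Suc i)\<rparr>) (F i)) = subq_depth \<mm> (A i) (A (Suc i))"
    if "i < r" for i \<mm>
  proof -
    have le: "i \<le> r" "Suc i \<le> r" using that by auto
    have AB: "A i \<subseteq> A (Suc i)" using inc[OF that] by (auto simp: A_def)
    show "module_dim ?R (quot_module (?M\<lparr>carrier := F (Suc i)\<rparr>) (F i)) = subq_dim (A i) (A (Suc i))"
      "depth ?R \<mm> (quot_module (?M\<lparr>carrier := F (Suc i)\<rparr>) (F i)) = subq_depth \<mm> (A i) (A (Suc i))"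
      unfolding A(3)[OF le(1)] A(3)[OF le(2)]
      by (rule subquotient_filtration_step[OF q.subquotient_axioms A(1)[OF le(1)] A(1)[OF le(2)]
            A(2)[OF le(1)] AB])+
  qed
  have "A 0 = J"
    using q.phi_eq_iff[of _ 0] by (auto simp: A_def F0 q.zero_eq simp del: add_0_right)
  moreover have "A r = UNIV" by (auto simp: A_def Fr q.carrier_eq)
  moreover have "A i \<subset> A (Suc i)" if "i < r" for i
  proof -
    have "A i \<noteq> A (Suc i)" using inc[OF that] A(3)[of i] A(3)[of "Suc i"] that by auto
    then show ?thesis using inc[OF that] by (auto simp: A_def)
  qed
  moreover have "subq_depth (sr_ideal {{}}) (A i) (A (Suc i)) = subq_dim (A i) (A (Suc i))" if "i < r" for i
    using cm[OF that] step[OF that] by (simp add: cohen_macaulay_def graded_maximal_ideal_eq)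
  moreover have "subq_dim (A i) (A (Suc i)) < subq_dim (A (Suc i)) (A (Suc (Suc i)))" if "Suc i < r" for i
    using dims[OF that] step(1)[of i] step(1)[of "Suc i"] that by simp
  ultimately have "cm_chain J r A" unfolding cm_chain_def using A(1) by blast
  then show ?thesis by blast
qed

text \<open>
  The submodules of the filtration have to be graded. This is ensured by ideals that contain all
  parts \<open>restr T p\<close> of each of their elements, in particular the homogeneous components.
\<close>
lemma cm_chain_imp_SCM:
  fixes J :: "('v::finite, 'k::field) mpoly set"
  assumes chain: "cm_chain J r A" and monomial: "\<And>i p T. i \<le> r \<Longrightarrow> p \<in> A i \<Longrightarrow> restr T p \<in> A i"
  shows "SCM J"
proof -
  let ?R = "mpoly_ring :: ('v, 'k) mpoly ring"
  let ?M = "quot_module (ring_as_module ?R) J"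
  let ?\<phi> = "\<lambda>p. (\<lambda>c. c + p) ` J"
  let ?gr = "\<lambda>d. (\<lambda>p. J +>\<^bsub>?R\<^esub> p) ` homogeneous_polys d"
  have J: "is_ideal J" using chain unfolding cm_chain_def by (metis le0)
  interpret q: subquotient ?M J UNIV ?\<phi> by (rule subquotient_quotient_ring[OF J])
  have ideal: "is_ideal (A i)" if "i \<le> r" for i using chain that unfolding cm_chain_def by blast
  have above: "J \<subseteq> A i" if "i \<le> r" for i using cm_chain_above[OF chain that] .
  define F where "F = (\<lambda>i. ?\<phi> ` A i)"
  have "graded_submodule ?R ?M ?gr (F i)" if i: "i \<le> r" for i
    unfolding graded_submodule_def
  proof (intro conjI ballI)
    show "submodule (F i) ?R ?M"
      unfolding F_def by (rule q.submodule_image[OF ideal[OF i]]) simp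
    fix x assume "x \<in> F i"
    then obtain p where p: "p \<in> A i" "x = ?\<phi> p" unfolding F_def by blast
    let ?D = "mono_deg ` keys p" and ?h = "\<lambda>d. restr {u. mono_deg u = d} p"
    have "p = (\<Sum>d\<in>?D. ?h d)"
    proof (rule poly_mapping_eqI)
      fix u
      have "lookup (\<Sum>d\<in>?D. ?h d) u = (\<Sum>d\<in>?D. if d = mono_deg u then lookup p u else 0)"
        unfolding lookup_sum lookup_restr by (intro sum.cong) auto
      also have "\<dots> = lookup p u" by (auto simp: in_keys_iff)
      finally show "lookup p u = lookup (\<Sum>d\<in>?D. ?h d) u" by simp
    qed
    then have "x = ?\<phi> (\<Sum>d\<in>?D. ?h d)" using p(2) by simp
    also have "\<dots> = (\<Oplus>\<^bsub>?M\<^esub>d\<in>?D. ?\<phi> (?h d))"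
      by (rule q.finsum_eq[symmetric]) auto
    finally have "x = (\<Oplus>\<^bsub>?M\<^esub>d\<in>?D. ?\<phi> (?h d))" .
    moreover have "?\<phi> (?h d) \<in> F i \<inter> ?gr d" for d
      using monomial[OF i p(1)]
      by (auto simp: F_def a_r_coset_type_ring homogeneous_polys_def keys_restr)
    ultimately show "\<exists>D c. finite D \<and> (\<forall>d\<in>D. c d \<in> F i \<inter> ?gr d) \<and> x = (\<Oplus>\<^bsub>?M\<^esub>d\<in>D. c d)"
      by (intro exI[of _ ?D] exI[of _ "\<lambda>d. ?\<phi> (?h d)"] conjI ballI) (simp, blast+)
  qed
  moreover have "F 0 = {\<zero>\<^bsub>?M\<^esub>}"
  proof -
    have "?\<phi> p = ?\<phi> 0" if "p \<in> J" for p using q.phi_eq_iff[of p 0] that by simp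
    moreover have "A 0 = J" using chain unfolding cm_chain_def by blast
    ultimately show ?thesis
      using is_ideal_zero[OF J] unfolding F_def q.zero_eq by blast
  qed
  moreover have "F r = carrier ?M"
    using chain unfolding F_def q.carrier_eq cm_chain_def by simp
  moreover have "F i \<subset> F (Suc i)" if "i < r" for i
  proof -
    have AB: "A i \<subset> A (Suc i)" using chain that unfolding cm_chain_def by blast
    then obtain p where p: "p \<in> A (Suc i)" "p \<notin> A i" by blast
    then have "?\<phi> p \<notin> F i"
      unfolding F_def using q.phi_image_iff[OF ideal above, of i p] that by auto
    then show ?thesis using AB p unfolding F_def by blast
  qed
  moreover have step: "module_dim ?R (quot_module (?M\<lparr>carrier := F (Suc i)\<rparr>) (F i)) = subq_dim (A i) (A (Suc i))"
    "depth ?R \<mm> (quot_module (?M\<lparr>carrier := F (Suc i)\<rparr>) (F i)) = subq_depth \<mm> (A i) (A (Suc i))"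
    if "i < r" for i \<mm>
  proof -
    have le: "i \<le> r" "Suc i \<le> r" using that by auto
    have AB: "A i \<subseteq> A (Suc i)" using chain that unfolding cm_chain_def by blast
    show "module_dim ?R (quot_module (?M\<lparr>carrier := F (Suc i)\<rparr>) (F i)) = subq_dim (A i) (A (Suc i))"
      "depth ?R \<mm> (quot_module (?M\<lparr>carrier := F (Suc i)\<rparr>) (F i)) = subq_depth \<mm> (A i) (A (Suc i))"
      unfolding F_def
      by (rule subquotient_filtration_step[OF q.subquotient_axioms ideal[OF le(1)] ideal[OF le(2)]
            above[OF le(1)] AB])+
  qed
  moreover have "cohen_macaulay ?R graded_maximal_ideal (quot_module (?M\<lparr>carrier := F (Suc i)\<rparr>) (F i))"
    if "i < r" for i
    using chain that by (simp add: cohen_macaulay_def step[OF that] graded_maximal_ideal_eq cm_chain_def)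
  moreover have "module_dim ?R (quot_module (?M\<lparr>carrier := F (Suc i)\<rparr>) (F i)) <
        module_dim ?R (quot_module (?M\<lparr>carrier := F (Suc (Suc i))\<rparr>) (F (Suc i)))" if "Suc i < r" for i
    using chain that step(1)[of i] step(1)[of "Suc i"] by (simp add: cm_chain_def)
  ultimately show ?thesis
    unfolding SCM_def sequentially_cohen_macaulay_def
    by (intro exI[of _ r] exI[of _ F] conjI allI impI)
qed


section \<open>Sequential Cohen-Macaulayness of three families of complexes\<close>

lemma restr_sr_ideal: "p \<in> sr_ideal \<Delta> \<Longrightarrow> restr T p \<in> sr_ideal \<Delta>"
  by (simp add: sr_ideal_def keys_restr)

lemma downset_card_less: "downset {F :: 'v::finite set. card F < n}"
  unfolding downset_def by (simp, meson card_mono finite le_less_trans)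

lemma SCM_skeleton:
  assumes "n \<le> 2" "n \<le> card (UNIV :: 'v::{finite,linorder} set)"
  shows "SCM (sr_ideal {F :: 'v set. card F < Suc n} :: ('v, 'k::field) mpoly set)"
proof -
  let ?J = "sr_ideal {F :: 'v set. card F < Suc n} :: ('v, 'k) mpoly set"
  let ?A = "\<lambda>i. if i = 0 then ?J else UNIV"
  have "0 \<notin> keys a" if "a \<in> ?J" for a using sr_ideal_no_constant[OF that] by simp
  then have "?J \<subset> UNIV" using no_constant_imp_proper[of ?J] by blast
  then have "cm_chain ?J 1 ?A"
    using cohen_macaulay_skeleton[OF assms, where 'k = 'k] is_ideal_sr_ideal[OF downset_card_less]
    by (simp add: cm_chain_def is_ideal_UNIV)
  then show ?thesis by (rule cm_chain_imp_SCM) (auto simp: restr_sr_ideal split: if_splits)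
qed

lemma SCM_edge_and_points:
  fixes i j k :: "'v::{finite,linorder}"
  assumes "i \<noteq> j" "k \<notin> {i, j}"
  shows "SCM (sr_ideal ({F. card F < 2} \<union> Pow {i, j}) :: ('v, 'k::field) mpoly set)"
proof -
  let ?J = "sr_ideal ({F. card F < 2} \<union> Pow {i, j}) :: ('v, 'k) mpoly set"
  let ?B = "face_prime {i, j} :: ('v, 'k) mpoly set"
  let ?A = "\<lambda>n. if n = 0 then ?J else if n = 1 then ?B else UNIV"
  note cm = cohen_macaulay_edge_and_points[OF assms, where 'k = 'k]
  have "is_ideal ?J" by (rule is_ideal_sr_ideal[OF downset_Un[OF downset_card_less downset_Pow]])
  then have "cm_chain ?J 2 ?A"
    unfolding cm_chain_def using cm is_ideal_face_prime[of "{i, j}", where 'k = 'k]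
    by (simp add: is_ideal_UNIV numeral_2_eq_2 All_less_Suc2 del: Pow_insert)
  then show ?thesis by (rule cm_chain_imp_SCM) (auto simp: restr_sr_ideal split: if_splits simp del: Pow_insert)
qed

text \<open>
  Every nonzero ideal of \<open>R/J\<close> has the full dimension \<open>n\<close>, because \<open>J\<close> is an intersection of two
  primes of this dimension. So the dimensions can only increase strictly if the filtration has a
  single step. Then \<open>R/J\<close> itself would be Cohen-Macaulay, but its depth is at most 1.
\<close>
lemma not_SCM_two_disjoint_faces:
  fixes V W :: "'v::{finite,linorder} set"
  assumes disj: "V \<inter> W = {}" and card: "card V = n" "card W = n" and n: "2 \<le> n"
  shows "\<not> SCM (sr_ideal (Pow V \<union> Pow W) :: ('v, 'k::field) mpoly set)"
proof
  let ?J = "sr_ideal (Pow V \<union> Pow W) :: ('v, 'k) mpoly set"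
  assume scm: "SCM ?J"
  have "is_ideal ?J" by (rule is_ideal_sr_ideal[OF downset_Un[OF downset_Pow downset_Pow]])
  then obtain r A where chain: "cm_chain ?J r A" using SCM_imp_cm_chain scm by blast
  have J: "?J = face_prime V \<inter> face_prime W" by (rule sr_ideal_Un)
  have "(1 :: ('v, 'k) mpoly) \<notin> ?J" by (simp add: sr_ideal_def)
  then have "r \<noteq> 0" using chain unfolding cm_chain_def by (metis UNIV_I)
  have lower: "enat n \<le> subq_dim ?J B" if "?J \<subset> B" for B
  proof -
    obtain b where b: "b \<in> B" "b \<notin> ?J" using \<open>?J \<subset> B\<close> by blast
    then consider "b \<notin> face_prime V" | "b \<notin> face_prime W" unfolding J by blast
    then show ?thesis
      using subq_dim_ge_face[of ?J V b B] subq_dim_ge_face[of ?J W b B] b(1) card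
      unfolding J by cases auto
  qed
  have upper: "subq_dim C B \<le> enat n" if C: "is_ideal C" "?J \<subseteq> C" for B C
  proof (rule subq_dim_le[where \<V> = "{V, W}"])
    show "card U \<le> n" if "U \<in> {V, W}" for U using that card by auto
    fix p b :: "('v, 'k) mpoly"
    assume "\<And>u U. u \<in> keys p \<Longrightarrow> U \<in> {V, W} \<Longrightarrow> \<not> keys u \<subseteq> U"
    then have "p \<in> ?J" by (auto simp: sr_ideal_def)
    then show "p * b \<in> C" using C is_ideal_mult_right[OF C(1)] by blast
  qed
  have "?J \<subset> A 1" using chain \<open>r \<noteq> 0\<close> unfolding cm_chain_def by force
  then have low1: "enat n \<le> subq_dim ?J (A 1)" by (rule lower)
  show False
  proof (cases "r = 1")
    case True
    then have "subq_depth (sr_ideal {{}}) ?J UNIV = subq_dim ?J (A 1)" and "A 1 = UNIV"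
      using chain unfolding cm_chain_def by auto
    moreover have "V \<noteq> {}" "W \<noteq> {}" using card n by auto
    ultimately have "enat n \<le> 1"
      using depth_two_disjoint_faces[OF disj, where 'k = 'k] low1 by (metis order_trans)
    then show False using n by (simp add: one_enat_def)
  next
    case False
    then have r: "Suc 0 < r" using \<open>r \<noteq> 0\<close> by simp
    then have "subq_dim (A 0) (A (Suc 0)) < subq_dim (A (Suc 0)) (A (Suc (Suc 0)))"
      and "A 0 = ?J" "is_ideal (A (Suc 0))"
      using chain unfolding cm_chain_def by auto
    moreover have "subq_dim (A (Suc 0)) (A (Suc (Suc 0))) \<le> enat n"
      using upper[OF \<open>is_ideal (A (Suc 0))\<close>] cm_chain_above[OF chain, of "Suc 0"] r by simp
    ultimately show False using low1 by simp
  qed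
qed

section \<open>Minimal monomial generators\<close>

lemma mono_dvd_refl: "mono_dvd u u"
  by (auto simp: mono_dvd_def intro: exI[of _ 0])

lemma mono_dvd_trans: "mono_dvd u v \<Longrightarrow> mono_dvd v w \<Longrightarrow> mono_dvd u w"
  by (auto simp: mono_dvd_def add.assoc)

lemma mono_dvd_iff: "mono_dvd u v \<longleftrightarrow> (\<forall>i. lookup u i \<le> lookup v i)"
proof
  assume "\<forall>i. lookup u i \<le> lookup v i"
  then have "v = u + (v - u)" by (intro poly_mapping_eqI) (simp add: lookup_add lookup_minus)
  then show "mono_dvd u v" unfolding mono_dvd_def by blast
qed (auto simp: mono_dvd_def lookup_add)

lemma mono_dvd_antisym: "mono_dvd u v \<Longrightarrow> mono_dvd v u \<Longrightarrow> u = v"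
  by (intro poly_mapping_eqI) (simp add: mono_dvd_iff order_antisym)

lemma mono_dvd_less_deg:
  assumes "mono_dvd u v" "u \<noteq> v"
  shows "mono_deg u < mono_deg v"
proof -
  from assms(1) obtain w where w: "v = u + w" by (auto simp: mono_dvd_def)
  then have "keys w \<noteq> {}" using assms(2) by auto
  then have "1 \<le> mono_deg w" by (rule mono_deg_pos)
  then show ?thesis by (simp add: w mono_deg_def lookup_add sum.distrib)
qed

lemma monomial_poly_mem_span:
  "(monomial_poly u :: ('v, 'k::field) mpoly) \<in> monomial_span_ideal S \<longleftrightarrow> (\<exists>s\<in>S. mono_dvd s u)"
  by (simp add: monomial_span_ideal_eq monomial_poly_def)

definition minimal_monomials :: "'v mono set \<Rightarrow> 'v mono set" where
  "minimal_monomials S = {s \<in> S. \<forall>t\<in>S. mono_dvd t s \<longrightarrow> t = s}"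

lemma exists_minimal_divisor:
  fixes s :: "'v::finite mono"
  assumes "s \<in> S"
  shows "\<exists>t\<in>minimal_monomials S. mono_dvd t s"
  using assms
proof (induction "mono_deg s" arbitrary: s rule: less_induct)
  case less
  show ?case
  proof (cases "s \<in> minimal_monomials S")
    case False
    then obtain t where t: "t \<in> S" "mono_dvd t s" "t \<noteq> s"
      using less.prems unfolding minimal_monomials_def by blast
    then show ?thesis
      using less.hyps[OF mono_dvd_less_deg[OF t(2,3)] t(1)] mono_dvd_trans by blast
  qed (use mono_dvd_refl in blast)
qed

lemma span_minimal_monomials:
  "(monomial_span_ideal (minimal_monomials S) :: ('v::finite, 'k::field) mpoly set) = monomial_span_ideal S"
proof -
  have "(\<exists>s\<in>minimal_monomials S. mono_dvd s u) \<longleftrightarrow> (\<exists>s\<in>S. mono_dvd s u)" for u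
  proof
    assume "\<exists>s\<in>S. mono_dvd s u"
    then show "\<exists>s\<in>minimal_monomials S. mono_dvd s u"
      using exists_minimal_divisor mono_dvd_trans by blast
  qed (auto simp: minimal_monomials_def)
  then show ?thesis by (simp add: monomial_span_ideal_eq)
qed

text \<open>
  A monomial that is minimal for divisibility in \<open>S\<close> must belong to every monomial generating set,
  and the minimal monomials alone generate.
\<close>
lemma min_monomial_gens_span:
  "min_monomial_gens (monomial_span_ideal S :: ('v::finite, 'k::field) mpoly set) = minimal_monomials S"
proof -
  let ?span = "\<lambda>T. monomial_span_ideal T :: ('v, 'k) mpoly set"
  have sub: "minimal_monomials S \<subseteq> T" if "?span T = ?span S" for T
  proof
    fix s assume s: "s \<in> minimal_monomials S"
    then have "monomial_poly s \<in> ?span S"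
      using mono_dvd_refl unfolding monomial_poly_mem_span minimal_monomials_def by blast
    then obtain t where t: "t \<in> T" "mono_dvd t s"
      unfolding \<open>?span T = ?span S\<close>[symmetric] monomial_poly_mem_span by blast
    then have "monomial_poly t \<in> ?span T"
      using mono_dvd_refl unfolding monomial_poly_mem_span by blast
    then obtain s' where s': "s' \<in> S" "mono_dvd s' t"
      unfolding \<open>?span T = ?span S\<close> monomial_poly_mem_span by blast
    then have "s' = s" using s t mono_dvd_trans unfolding minimal_monomials_def by blast
    then have "t = s" using mono_dvd_antisym s' t by blast
    then show "s \<in> T" using t by simp
  qed
  show ?thesis
    unfolding min_monomial_gens_def
  proof (rule the_equality)
    show "?span (minimal_monomials S) = ?span S \<and>
        (\<forall>T. T \<subset> minimal_monomials S \<longrightarrow> ?span T \<noteq> ?span S)"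
      using sub span_minimal_monomials by blast
    show "T = minimal_monomials S"
      if "?span T = ?span S \<and> (\<forall>T'. T' \<subset> T \<longrightarrow> ?span T' \<noteq> ?span S)" for T
    proof -
      have "minimal_monomials S \<subseteq> T" using that sub by blast
      moreover have "\<not> minimal_monomials S \<subset> T" using that span_minimal_monomials by blast
      ultimately show ?thesis by blast
    qed
  qed
qed

section \<open>Square-free monomials as sets of variables\<close>

lemma squarefree_lookup: "mono_squarefree u \<Longrightarrow> lookup u i = (if i \<in> keys u then 1 else 0)"
  unfolding mono_squarefree_def
  by (metis One_nat_def in_keys_iff le_Suc_eq le_zero_eq)

lemma squarefree_deg: "mono_squarefree u \<Longrightarrow> mono_deg u = card (keys u)"
  unfolding mono_deg_def by (simp add: squarefree_lookup sum.If_cases)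

lemma squarefree_dvd_iff:
  assumes "mono_squarefree u"
  shows "mono_dvd u v \<longleftrightarrow> keys u \<subseteq> keys v"
proof -
  have "lookup u i \<le> lookup v i \<longleftrightarrow> (i \<in> keys u \<longrightarrow> i \<in> keys v)" for i
    by (simp add: squarefree_lookup[OF assms] in_keys_iff[of i v] Suc_le_eq)
  then show ?thesis unfolding mono_dvd_iff by blast
qed

lemma inj_on_keys_squarefree: "inj_on keys {u. mono_squarefree u}"
  by (intro inj_onI poly_mapping_eqI) (simp add: squarefree_lookup)

definition mono_of_set :: "'v::finite set \<Rightarrow> 'v mono" where
  "mono_of_set E = (\<Sum>i\<in>E. single i 1)"

lemma lookup_mono_of_set: "lookup (mono_of_set E) i = (if i \<in> E then 1 else 0)"
  by (simp add: mono_of_set_def lookup_sum lookup_single when_def)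

lemma keys_mono_of_set: "keys (mono_of_set E) = E"
  by (auto simp: in_keys_iff lookup_mono_of_set split: if_splits)

lemma squarefree_mono_of_set: "mono_squarefree (mono_of_set E)"
  by (simp add: mono_squarefree_def lookup_mono_of_set)

lemma keys_image_squarefree:
  "keys ` {u :: 'v::finite mono. mono_squarefree u \<and> mono_deg u = d} = {E. card E = d}"
proof (intro equalityI subsetI)
  fix E :: "'v set" assume "E \<in> {E. card E = d}"
  then have "mono_of_set E \<in> {u. mono_squarefree u \<and> mono_deg u = d}"
    by (simp add: squarefree_mono_of_set squarefree_deg keys_mono_of_set)
  then show "E \<in> keys ` {u :: 'v mono. mono_squarefree u \<and> mono_deg u = d}"
    by (metis keys_mono_of_set image_eqI)
qed (auto simp: squarefree_deg)

lemma minimal_monomials_same_degree: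
  assumes "\<And>u. u \<in> S \<Longrightarrow> mono_deg u = d"
  shows "minimal_monomials S = S"
  unfolding minimal_monomials_def using assms mono_dvd_less_deg by fastforce

lemma span_squarefree:
  assumes "\<And>u. u \<in> G \<Longrightarrow> mono_squarefree u"
  shows "monomial_span_ideal G = sr_ideal {F. \<forall>E\<in>keys ` G. \<not> E \<subseteq> F}"
  using assms by (auto simp: monomial_span_ideal_eq sr_ideal_def squarefree_dvd_iff)

lemma exists_mono_gcd:
  fixes G :: "'v::finite mono set"
  assumes "G \<noteq> {}"
  shows "\<exists>g. (\<forall>u\<in>G. mono_dvd g u) \<and> (\<forall>h. (\<forall>u\<in>G. mono_dvd h u) \<longrightarrow> mono_dvd h g)"
proof -
  let ?m = "\<lambda>i. LEAST n. \<exists>u\<in>G. n = lookup u i"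
  have m: "\<exists>u\<in>G. ?m i = lookup u i" for i
    using LeastI_ex[of "\<lambda>n. \<exists>u\<in>G. n = lookup u i"] assms by blast
  define g where "g = Abs_poly_mapping ?m"
  have g: "lookup g = ?m" unfolding g_def by simp
  show ?thesis
  proof (intro exI[of _ g] conjI ballI allI impI)
    show "mono_dvd g u" if "u \<in> G" for u
      unfolding mono_dvd_iff g using that by (auto intro: Least_le)
    show "mono_dvd h g" if "\<forall>u\<in>G. mono_dvd h u" for h
      unfolding mono_dvd_iff g using m that unfolding mono_dvd_iff by metis
  qed
qed

section \<open>Matroids on four elements\<close>

text \<open>
  The bases are the edges of a graph in which non-adjacency is transitive (by the exchange property).
  If two non-edges shared a vertex, then three vertices would be pairwise non-adjacent, so that all
  edges would pass through the fourth one and the intersection of all bases would not be empty. So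
  the non-edges are pairwise disjoint, and there are at most two of them.
\<close>
lemma matroid_rank_two_on_four:
  fixes H :: "'v::finite set set"
  assumes card: "card (UNIV :: 'v set) = 4" and H: "\<And>E. E \<in> H \<Longrightarrow> card E = 2"
    and exch: "\<And>E F i. E \<in> H \<Longrightarrow> F \<in> H \<Longrightarrow> i \<in> E - F \<Longrightarrow> \<exists>j\<in>F - E. insert j (E - {i}) \<in> H"
    and supp: "\<Union>H = UNIV" and gcd: "\<Inter>H = {}"
  shows "H = {E. card E = 2} \<or> (\<exists>i j. i \<noteq> j \<and> H = {E. card E = 2} - {{i, j}}) \<or>
    (\<exists>i j k l. UNIV = {i, j, k, l} \<and> distinct [i, j, k, l] \<and> H = {E. card E = 2} - {{i, j}, {k, l}})"
proof -
  have other: "\<exists>l. UNIV = {i, j, k, l} \<and> distinct [i, j, k, l]" if "distinct [i, j, k]" for i j k :: 'v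
  proof -
    have "card (UNIV - {i, j, k}) = 1" using that card by (simp add: card_Diff_subset)
    then obtain l where "UNIV - {i, j, k} = {l}" by (auto simp: card_1_singleton_iff)
    then show ?thesis using that by (intro exI[of _ l]) auto
  qed
  define e where "e x y \<longleftrightarrow> {x, y} \<in> H" for x y
  have e_sym: "e x y \<longleftrightarrow> e y x" for x y by (simp add: e_def insert_commute)
  have e_irrefl: "x \<noteq> y" if "e x y" for x y using H[of "{x, y}"] that by (auto simp: e_def)
  have edge: "\<exists>x y. E = {x, y} \<and> e x y" if "E \<in> H" for E
    using H[OF that] that by (auto simp: card_2_iff e_def)
  have neighbour: "\<exists>y. e x y" for x
  proof -
    obtain E where "E \<in> H" "x \<in> E" using supp by blast
    then show ?thesis using edge[of E] e_sym by blast
  qed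
  have exchange: "e x a \<or> e x b" if "e x y" "e a b" "y \<noteq> a" "y \<noteq> b" for x y a b
  proof -
    have "{x, y} - {y} = {x}" using e_irrefl[OF that(1)] by auto
    moreover have "\<exists>j\<in>{a, b} - {x, y}. insert j ({x, y} - {y}) \<in> H"
      using that by (intro exch) (auto simp: e_def)
    ultimately have "e a x \<or> e b x" by (auto simp: e_def)
    then show ?thesis using e_sym by blast
  qed
  have avoid: "\<exists>x y. e x y \<and> x \<noteq> l \<and> y \<noteq> l" for l
  proof -
    obtain E where "E \<in> H" "l \<notin> E" using gcd by blast
    then show ?thesis using edge[of E] by blast
  qed
  have parallel: False if d: "distinct [i, j, k]" and n: "\<not> e i j" "\<not> e j k" for i j k
  proof -
    obtain l where l: "UNIV = {i, j, k, l}" "distinct [i, j, k, l]" using other[OF d] by blast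
    have cases4: "x = i \<or> x = j \<or> x = k \<or> x = l" for x using l(1) by blast
    have "e j l" using neighbour[of j] cases4 n e_sym e_irrefl by metis
    then have "\<not> e i k" using exchange[of j l i k] n e_sym l(2) by auto
    obtain x y where xy: "e x y" "x \<noteq> l" "y \<noteq> l" using avoid by blast
    have "x = i \<or> x = j \<or> x = k" "y = i \<or> y = j \<or> y = k" using cases4 xy by blast+
    then show False using xy(1) n \<open>\<not> e i k\<close> e_sym e_irrefl by metis
  qed
  show ?thesis
  proof (cases "H = {E. card E = 2}")
    case False
    then obtain E where "card E = 2" "E \<notin> H" using H by blast
    then obtain i j where ij: "\<not> e i j" "i \<noteq> j" by (auto simp: card_2_iff e_def)
    show ?thesis
    proof (cases "H = {E. card E = 2} - {{i, j}}")
      case True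
      then show ?thesis using ij(2) by blast
    next
      case False
      moreover have "H \<subseteq> {E. card E = 2} - {{i, j}}" using H ij(1) by (auto simp: e_def)
      ultimately obtain E where E: "card E = 2" "E \<noteq> {i, j}" "E \<notin> H" by blast
      then obtain k l where kl: "E = {k, l}" "k \<noteq> l" by (auto simp: card_2_iff)
      then have nkl: "\<not> e k l" using E(3) by (simp add: e_def)
      have disjoint: "distinct [i, j, x, y]" if "\<not> e x y" "x \<noteq> y" "{x, y} \<noteq> {i, j}" for x y
      proof -
        have p: "\<not> e a b \<Longrightarrow> \<not> e b c \<Longrightarrow> a \<noteq> b \<Longrightarrow> b \<noteq> c \<Longrightarrow> a = c" for a b c
          using parallel[of a b c] by auto
        have "\<not> (x = i \<and> y = j)" "\<not> (x = j \<and> y = i)" using that(3) by (auto simp: insert_commute)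
        then have "x \<noteq> i" "x \<noteq> j" "y \<noteq> i" "y \<noteq> j"
          using p ij that(1,2) e_sym by metis+
        then show ?thesis using ij(2) that(2) by simp
      qed
      have dist: "distinct [i, j, k, l]" using disjoint[OF nkl kl(2)] E(2) kl(1) by blast
      have univ: "UNIV = {i, j, k, l}"
      proof -
        obtain m where "UNIV = {i, j, k, m}" using other[of i j k] dist by auto
        moreover from this have "l = m" using dist by auto
        ultimately show ?thesis by simp
      qed
      have "F \<in> H" if F: "card F = 2" "F \<noteq> {i, j}" "F \<noteq> {k, l}" for F
      proof (rule ccontr)
        assume "F \<notin> H"
        obtain x y where xy: "F = {x, y}" "x \<noteq> y" using F(1) by (auto simp: card_2_iff)
        then have "distinct [i, j, x, y]" using disjoint[of x y] F(2) \<open>F \<notin> H\<close> by (simp add: e_def)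
        moreover have "x \<in> {i, j, k, l}" "y \<in> {i, j, k, l}" using univ by blast+
        ultimately have "F = {k, l}" using xy by auto
        then show False using F(3) by simp
      qed
      then have "H = {E. card E = 2} - {{i, j}, {k, l}}"
        using H ij(1) nkl unfolding e_def by blast
      then show ?thesis using dist univ by blast
    qed
  qed simp
qed

text \<open>
  In rank 1 every singleton is a basis because the bases cover everything. In rank 3 every
  complement of a point is a basis because no point lies in all bases. Ranks 0 and 4 contradict
  these two conditions.
\<close>
lemma matroid_on_four:
  fixes H :: "'v::finite set set"
  assumes card: "card (UNIV :: 'v set) = 4" and H: "\<And>E. E \<in> H \<Longrightarrow> card E = d"
    and exch: "\<And>E F i. E \<in> H \<Longrightarrow> F \<in> H \<Longrightarrow> i \<in> E - F \<Longrightarrow> \<exists>j\<in>F - E. insert j (E - {i}) \<in> H"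
    and supp: "\<Union>H = UNIV" and gcd: "\<Inter>H = {}"
  shows "1 \<le> d \<and> d \<le> 3 \<and> H = {E. card E = d} \<or>
    d = 2 \<and> (\<exists>i j. i \<noteq> j \<and> H = {E. card E = 2} - {{i, j}}) \<or>
    d = 2 \<and> (\<exists>i j k l. UNIV = {i, j, k, l} \<and> distinct [i, j, k, l] \<and> H = {E. card E = 2} - {{i, j}, {k, l}})"
proof -
  have with_elem: "\<exists>E\<in>H. i \<in> E" for i using supp by blast
  have without: "\<exists>E\<in>H. i \<notin> E" for i using gcd by blast
  have "d \<noteq> 0"
  proof
    assume "d = 0"
    moreover obtain E where "E \<in> H" "undefined \<in> E" using with_elem by blast
    ultimately show False using H[of E] by simp
  qed
  moreover have "d < 4"
  proof -
    obtain E i where "E \<in> H" "i \<notin> E" using without by blast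
    then have "card E < card (UNIV :: 'v set)" by (intro psubset_card_mono) auto
    then show ?thesis using H[OF \<open>E \<in> H\<close>] card by simp
  qed
  ultimately consider "d = 1" | "d = 2" | "d = 3" by linarith
  then show ?thesis
  proof cases
    case 1
    have "{i} \<in> H" for i
      using with_elem[of i] H 1 by (metis card_1_singletonE singletonD)
    then have "H = {E. card E = d}" using H 1 by (auto simp: card_1_singleton_iff)
    then show ?thesis using 1 by simp
  next
    case 2
    then show ?thesis
      using matroid_rank_two_on_four[OF card H[unfolded 2] exch supp gcd] by auto
  next
    case 3
    have compl: "\<exists>i. F = - {i}" if "card F = 3" for F :: "'v set"
    proof -
      have "card (- F) = 1" using that card by (simp add: Compl_eq_Diff_UNIV card_Diff_subset)
      then obtain i where "- F = {i}" by (auto simp: card_1_singleton_iff)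
      then show ?thesis by (metis double_complement)
    qed
    have "- {i} \<in> H" for i
    proof -
      obtain E where E: "E \<in> H" "i \<notin> E" using without by blast
      then obtain j where "E = - {j}" using compl H 3 by blast
      then show ?thesis using E by auto
    qed
    then have "H = {E. card E = d}" using H compl 3 by blast
    then show ?thesis using 3 by simp
  qed
qed


section \<open>From bases to complexes\<close>

lemma faces_avoiding_all_subsets:
  assumes "n < card (UNIV :: 'v::finite set)"
  shows "{F :: 'v set. \<forall>E\<in>{E. card E = Suc n}. \<not> E \<subseteq> F} = {F. card F < Suc n}"
proof (intro equalityI subsetI)
  fix F :: "'v set" assume F: "F \<in> {F. \<forall>E\<in>{E. card E = Suc n}. \<not> E \<subseteq> F}"
  show "F \<in> {F. card F < Suc n}"
  proof (rule ccontr)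
    assume "F \<notin> {F. card F < Suc n}"
    then obtain E where "E \<subseteq> F" "card E = Suc n"
      using exists_subset_between[of "{}" "Suc n" F] by auto
    then show False using F by blast
  qed
next
  fix F :: "'v set" assume "F \<in> {F. card F < Suc n}"
  then have "\<not> E \<subseteq> F" if "card E = Suc n" for E
    using card_mono[of F E] that by auto
  then show "F \<in> {F. \<forall>E\<in>{E. card E = Suc n}. \<not> E \<subseteq> F}" by blast
qed

lemma faces_avoiding_all_but_one:
  assumes "i \<noteq> j"
  shows "{F :: 'v::finite set. \<forall>E\<in>{E. card E = 2} - {{i, j}}. \<not> E \<subseteq> F} = {F. card F < 2} \<union> Pow {i, j}"
proof (intro equalityI subsetI)
  fix F :: "'v set" assume F: "F \<in> {F. \<forall>E\<in>{E. card E = 2} - {{i, j}}. \<not> E \<subseteq> F}"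
  then have pairs: "{x, y} = {i, j}" if "x \<in> F" "y \<in> F" "x \<noteq> y" for x y
  proof -
    have "card {x, y} = 2" "{x, y} \<subseteq> F" using that by simp_all
    then show ?thesis using F by blast
  qed
  show "F \<in> {F. card F < 2} \<union> Pow {i, j}"
  proof (cases "card F < 2")
    case False
    then obtain E where E: "E \<subseteq> F" "card E = 2"
      using exists_subset_between[of "{}" 2 F] by auto
    then obtain x y where xy: "x \<in> F" "y \<in> F" "x \<noteq> y" by (auto simp: card_2_iff)
    have "z \<in> {i, j}" if "z \<in> F" for z
      using pairs[OF that xy(1)] pairs[OF that xy(2)] xy by blast
    then show ?thesis by blast
  qed simp
next
  fix F assume F: "F \<in> {F. card F < 2} \<union> Pow {i, j}"
  have "E = {i, j}" if "card E = 2" "E \<subseteq> F" for E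
  proof -
    have "F \<subseteq> {i, j}" using F that card_mono[of F E] by auto
    then show ?thesis using that assms card_seteq[of "{i, j}" E] by auto
  qed
  then show "F \<in> {F. \<forall>E\<in>{E. card E = 2} - {{i, j}}. \<not> E \<subseteq> F}" by blast
qed

lemma faces_avoiding_all_but_two_disjoint:
  assumes univ: "UNIV = {i, j, k, l}" and d: "distinct [i, j, k, l]"
  shows "{F. \<forall>E\<in>{E. card E = 2} - {{i, j}, {k, l}}. \<not> E \<subseteq> F} = Pow {i, j} \<union> Pow {k, l}"
proof (intro equalityI subsetI)
  fix F assume F: "F \<in> {F. \<forall>E\<in>{E. card E = 2} - {{i, j}, {k, l}}. \<not> E \<subseteq> F}"
  have mixed: "False" if "x \<in> F" "y \<in> F" "x \<in> {i, j}" "y \<in> {k, l}" for x y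
  proof -
    have "{x, y} \<in> {E. card E = 2} - {{i, j}, {k, l}}" using that d by (auto simp: card_2_iff)
    moreover have "{x, y} \<subseteq> F" using that by blast
    ultimately show False using F by blast
  qed
  have "F \<subseteq> {i, j} \<union> {k, l}" using univ by blast
  then show "F \<in> Pow {i, j} \<union> Pow {k, l}" using mixed by blast
next
  fix F assume F: "F \<in> Pow {i, j} \<union> Pow {k, l}"
  have "E \<in> {{i, j}, {k, l}}" if "card E = 2" "E \<subseteq> F" for E
    using F that d card_seteq[of "{i, j}" E] card_seteq[of "{k, l}" E] by auto
  then show "F \<in> {F. \<forall>E\<in>{E. card E = 2} - {{i, j}, {k, l}}. \<not> E \<subseteq> F}" by blast
qed

lemma matroidal_ideal_bases:
  fixes J :: "('v::finite, 'k::field) mpoly set"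
  assumes mat: "matroidal_ideal d J" and supp: "ideal_supp J = UNIV" and gcd: "ideal_gcd J = 0"
  defines "G \<equiv> min_monomial_gens J"
  shows "J = monomial_span_ideal G"
    and "\<And>u. u \<in> G \<Longrightarrow> mono_squarefree u \<and> mono_deg u = d"
    and "\<And>E F i. E \<in> keys ` G \<Longrightarrow> F \<in> keys ` G \<Longrightarrow> i \<in> E - F \<Longrightarrow> \<exists>j\<in>F - E. insert j (E - {i}) \<in> keys ` G"
    and "\<Union>(keys ` G) = UNIV" and "\<Inter>(keys ` G) = {}"
proof -
  have poly: "polymatroidal_ideal d J" and sqf: "\<And>u. u \<in> G \<Longrightarrow> mono_squarefree u"
    using mat by (auto simp: matroidal_ideal_def G_def)
  then obtain S where S: "J = monomial_span_ideal S"
    by (auto simp: polymatroidal_ideal_def monomial_ideal_def)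
  then show "J = monomial_span_ideal G"
    unfolding G_def by (simp add: min_monomial_gens_span span_minimal_monomials)
  show "mono_squarefree u \<and> mono_deg u = d" if "u \<in> G" for u
    using that poly sqf by (auto simp: polymatroidal_ideal_def G_def)
  have single_dvd: "mono_dvd (single i 1) u \<longleftrightarrow> i \<in> keys u" for i and u :: "'v mono"
    by (subst squarefree_dvd_iff) (auto simp: mono_squarefree_def lookup_single when_def)
  show union: "\<Union>(keys ` G) = UNIV"
    using supp unfolding ideal_supp_def G_def[symmetric] single_dvd by auto
  then have "G \<noteq> {}" by auto
  from exists_mono_gcd[OF this] obtain g where
    g: "\<forall>u\<in>G. mono_dvd g u" "\<forall>h. (\<forall>u\<in>G. mono_dvd h u) \<longrightarrow> mono_dvd h g" by blast
  have "ideal_gcd J = g"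
    unfolding ideal_gcd_def G_def[symmetric]
    using g mono_dvd_antisym by (intro the_equality) blast+
  then have "g = 0" using gcd by simp
  show "\<Inter>(keys ` G) = {}"
  proof (rule ccontr)
    assume "\<Inter>(keys ` G) \<noteq> {}"
    then obtain i where "\<forall>u\<in>G. i \<in> keys u" by auto
    then have "mono_dvd (single i 1) g" using g(2) single_dvd by blast
    then show False using \<open>g = 0\<close> single_dvd by simp
  qed
  fix E F i assume EF: "E \<in> keys ` G" "F \<in> keys ` G" "i \<in> E - F"
  then obtain u v where uv: "u \<in> G" "v \<in> G" "E = keys u" "F = keys v" by blast
  note lu = squarefree_lookup[OF sqf[OF uv(1)]] and lv = squarefree_lookup[OF sqf[OF uv(2)]]
  have "lookup v i < lookup u i" using EF(3) uv by (simp add: lu lv)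
  then obtain j where j: "lookup u j < lookup v j" "single j 1 + (u - single i 1) \<in> G"
    using poly uv(1,2) unfolding polymatroidal_ideal_def G_def by blast
  have "j \<in> F - E" using j(1) uv by (auto simp: lu lv split: if_splits)
  moreover have "keys (u - single i 1) = E - {i}"
  proof -
    have "x \<in> keys (u - single i 1) \<longleftrightarrow> x \<in> E - {i}" for x
      using in_keys_iff[of x "u - single i 1"] uv(3)
      by (simp add: lookup_minus lookup_single lu when_def)
    then show ?thesis by blast
  qed
  then have "keys (single j 1 + (u - single i 1)) = insert j (E - {i})"
    unfolding keys_mono_add by simp
  ultimately show "\<exists>j\<in>F - E. insert j (E - {i}) \<in> keys ` G"
    using j(2) by (metis image_eqI)
qed

text \<open>
  Only the number of bases matters, because the minimal generators of the square-free Veronese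
  ideal are all square-free monomials of degree \<open>d\<close>.
\<close>
lemma veronese_or_almost_iff:
  fixes J :: "('v::finite, 'k::field) mpoly set"
  defines "G \<equiv> min_monomial_gens J"
  assumes J: "J = monomial_span_ideal G" and G: "\<And>u. u \<in> G \<Longrightarrow> mono_squarefree u \<and> mono_deg u = d"
    and ne: "G \<noteq> {}"
  shows "J = sqfree_veronese d \<or> almost_sqfree_veronese d J \<longleftrightarrow>
    card {E :: 'v set. card E = d} - 1 \<le> card (keys ` G)"
proof -
  let ?V = "{u :: 'v mono. mono_squarefree u \<and> mono_deg u = d}"
  have V: "min_monomial_gens (sqfree_veronese d :: ('v, 'k) mpoly set) = ?V"
    unfolding sqfree_veronese_def min_monomial_gens_span
    by (rule minimal_monomials_same_degree[where d = d]) simp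
  have inj: "inj_on keys ?V" "inj_on keys G"
    using inj_on_keys_squarefree G by (auto simp: inj_on_def)
  have cV: "card ?V = card {E :: 'v set. card E = d}"
    using card_image[OF inj(1)] by (simp add: keys_image_squarefree)
  have cG: "card G = card (keys ` G)" using card_image[OF inj(2)] by simp
  obtain u where "u \<in> G" using ne by blast
  then have "(monomial_poly u :: ('v, 'k) mpoly) \<in> J"
    using J mono_dvd_refl monomial_poly_mem_span by blast
  moreover have "(monomial_poly u :: ('v, 'k) mpoly) \<noteq> 0"
    using keys_single[of u "1 :: 'k"] unfolding monomial_poly_def by force
  ultimately have "J \<noteq> {0}" by blast
  moreover have "monomial_ideal J" using J unfolding monomial_ideal_def by blast
  ultimately have "almost_sqfree_veronese d J \<longleftrightarrow> card {E :: 'v set. card E = d} - 1 \<le> card (keys ` G)"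
    unfolding almost_sqfree_veronese_def V G_def[symmetric] cV cG using G by blast
  moreover have "G = ?V" if "J = sqfree_veronese d" using V that by (simp add: G_def)
  then have "card {E :: 'v set. card E = d} - 1 \<le> card (keys ` G)" if "J = sqfree_veronese d"
    using that cV cG by simp
  ultimately show ?thesis by blast
qed

theorem SCM_iff_on_four_variables:
  fixes J :: "('v::{finite,linorder}, 'k::field) mpoly set"
  assumes card: "card (UNIV :: 'v set) = 4"
    and mat: "matroidal_ideal d J" "ideal_supp J = UNIV" "ideal_gcd J = 0"
  shows "SCM J \<longleftrightarrow> J = sqfree_veronese d \<or> almost_sqfree_veronese d J"
proof -
  define G where "G = min_monomial_gens J"
  define H where "H = keys ` G"
  note bases = matroidal_ideal_bases[OF mat, folded G_def, folded H_def]
  have "G \<noteq> {}" using bases(4) by (auto simp: H_def)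
  then have rhs: "J = sqfree_veronese d \<or> almost_sqfree_veronese d J \<longleftrightarrow>
      card {E :: 'v set. card E = d} - 1 \<le> card H"
    using veronese_or_almost_iff[of J d] bases(1,2) unfolding G_def H_def by blast
  have J: "J = sr_ideal {F. \<forall>E\<in>H. \<not> E \<subseteq> F}"
    using span_squarefree[of G] bases(1,2) unfolding H_def by blast
  have Hcard: "card E = d" if "E \<in> H" for E
    using that bases(2) squarefree_deg unfolding H_def by fastforce
  have "1 \<le> d \<and> d \<le> 3 \<and> H = {E. card E = d} \<or>
    d = 2 \<and> (\<exists>i j. i \<noteq> j \<and> H = {E. card E = 2} - {{i, j}}) \<or>
    d = 2 \<and> (\<exists>i j k l. UNIV = {i, j, k, l} \<and> distinct [i, j, k, l] \<and> H = {E. card E = 2} - {{i, j}, {k, l}})"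
    by (rule matroid_on_four[OF card Hcard bases(3,4,5)])
  then consider (all) "1 \<le> d" "d \<le> 3" "H = {E. card E = d}"
    | (one) i j where "d = 2" "i \<noteq> j" "H = {E. card E = 2} - {{i, j}}"
    | (two) i j k l where "d = 2" "UNIV = {i, j, k, l}" "distinct [i, j, k, l]"
        "H = {E. card E = 2} - {{i, j}, {k, l}}"
    by blast
  then show ?thesis
  proof cases
    case all
    obtain n where n: "d = Suc n" using all(1) by (cases d) auto
    have "J = sr_ideal {F. card F < Suc n}"
      using faces_avoiding_all_subsets[of n, where 'v = 'v] n all card unfolding J by simp
    moreover have "SCM (sr_ideal {F :: 'v set. card F < Suc n} :: ('v, 'k) mpoly set)"
      by (rule SCM_skeleton) (use n all card in simp_all)
    ultimately show ?thesis using rhs all by simp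
  next
    case one
    have "card {i, j} < card (UNIV :: 'v set)" using card one by simp
    then obtain k where "k \<notin> {i, j}" by (metis UNIV_eq_I less_irrefl)
    have "J = sr_ideal ({F. card F < 2} \<union> Pow {i, j})"
      using faces_avoiding_all_but_one[OF one(2)] one(3) unfolding J by simp
    then have "SCM J"
      using SCM_edge_and_points[OF one(2) \<open>k \<notin> {i, j}\<close>, where 'k = 'k] by simp
    moreover have "card H = card {E :: 'v set. card E = 2} - 1"
      using one(2,3) by (simp add: card_Diff_subset)
    ultimately show ?thesis using rhs one(1) by simp
  next
    case two
    have "J = sr_ideal (Pow {i, j} \<union> Pow {k, l})"
      using faces_avoiding_all_but_two_disjoint[OF two(2,3)] two(4) unfolding J by simp
    moreover have "\<not> SCM (sr_ideal (Pow {i, j} \<union> Pow {k, l}) :: ('v, 'k) mpoly set)"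
      by (rule not_SCM_two_disjoint_faces[where n = 2]) (use two(3) in auto)
    ultimately have "\<not> SCM J" by simp
    moreover have "\<not> card {E :: 'v set. card E = d} - 1 \<le> card H"
    proof -
      have sub: "{{i, j}, {k, l}} \<subseteq> {E :: 'v set. card E = 2}" using two(3) by auto
      have "{i, j} \<noteq> {k, l}" using two(3) by auto
      then have "card {{i, j}, {k, l}} = 2" by simp
      moreover have "card {{i, j}, {k, l}} \<le> card {E :: 'v set. card E = 2}"
        using sub by (rule card_mono[rotated]) simp
      moreover have "card H = card {E :: 'v set. card E = 2} - card {{i, j}, {k, l}}"
        unfolding two(4) using sub by (intro card_Diff_subset) auto
      ultimately show ?thesis using two(1) by simp
    qed
    ultimately show ?thesis using rhs by blast
  qed
qed

theorem proposition4p3: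
  fixes J :: "(4, 'k::field) mpoly set" and d :: nat
  assumes "matroidal_ideal d J"
    and "ideal_supp J = UNIV"
    and "ideal_gcd J = 0"
  shows "SCM J \<longleftrightarrow> J = sqfree_veronese d \<or> almost_sqfree_veronese d J"
  by (rule SCM_iff_on_four_variables[OF _ assms]) simp

end
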